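(* Let $n>2$. The graph $X_n$ on arc permutations has the following properties. (i) The diameter of $X_n$ is $\binom{n}{2}$. (ii) The vertices $e$ and $w_0$ are antipodes in $X_n$. (iii) The number of vertices in geodesics between $e$ and $w_0$ is $2^n-2$. (iv) The number of geodesics between $e$ and $w_0$ is $2\binom{n}{2}!\cdot\prod_{i=0}^{n-2}\frac{i!}{(2i+1)!}$.
   Context: An interval in $\mathbb{Z}_n$ is a subset of $\{1,\dots,n\}$ of the form $[a,b]$ or $[b,n]\cup[1,a]$ with $1\le a\le b\le n$. A permutation $\pi\in\mathcal{S}_n$ is an arc permutation if for every $1\le j\le n$ the set $\{\pi(1),\dots,\pi(j)\}$ is an interval in $\mathbb{Z}_n$; $\mathcal{A}_n$ is the set of arc permutations. $X_n$ is the graph with vertex set $\mathcal{A}_n$ in which $u,v\in\mathcal{A}_n$ are adjacent iff $u=v\sigma_i$ for some adjacent transposition $\sigma_i=(i,i+1)$, $1\le i\le n-1$ (i.e. $u$ is obtained from $v$ by exchanging the letters in positions $i$ and $i+1$). $e=12\cdots n$ is the identity and $w_0=n\cdots21$. Two vertices are antipodes if their distance equals the diameter of the graph. A geodesic between two vertices is a shortest path between them (endpoints included among its vertices). *)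

theory Defs
  imports
    "Graph_Theory.Graph_Theory"
    "HOL-Combinatorics.Permutations"
begin

section \<open>Distances in unweighted graphs\<close>

text \<open>
  A graph is a \<^locale>\<open>graph\<close> of the entry Graph_Theory, that is, a finite symmetric digraph
  without loops and without multiple arcs.  Unit weights turn its weighted distance into the usual
  graph distance; the value is extended real, infinite between different components.
\<close>

definition graph_dist :: "('a, 'b) pre_digraph \<Rightarrow> 'a \<Rightarrow> 'a \<Rightarrow> ereal" where
  "graph_dist G u v = wf_digraph.\<mu> G (\<lambda>_. 1) u v"

definition graph_diameter :: "('a, 'b) pre_digraph \<Rightarrow> ereal" where
  "graph_diameter G = (SUP (u, v) \<in> verts G \<times> verts G. graph_dist G u v)"

definition antipodes :: "('a, 'b) pre_digraph \<Rightarrow> 'a \<Rightarrow> 'a \<Rightarrow> bool" where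
  "antipodes G u v \<longleftrightarrow>
     u \<in> verts G \<and> v \<in> verts G \<and> graph_dist G u v = graph_diameter G"

text \<open>
  A geodesic is given by its list of arcs, directed from the first end point to the second one.
  Without multiple arcs this list is determined by the sequence of vertices.
\<close>

definition geodesic :: "('a, 'b) pre_digraph \<Rightarrow> 'a \<Rightarrow> 'b awalk \<Rightarrow> 'a \<Rightarrow> bool" where
  "geodesic G u p v \<longleftrightarrow>
     pre_digraph.apath G u p v \<and> ereal (real (length p)) = graph_dist G u v"

section \<open>The graph of arc permutations\<close>

definition cyclic_interval :: "nat \<Rightarrow> nat set \<Rightarrow> bool" where
  "cyclic_interval n S \<longleftrightarrow>
     (\<exists>a b. 1 \<le> a \<and> a \<le> b \<and> b \<le> n \<and> (S = {a..b} \<or> S = {b..n} \<union> {1..a}))"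

definition arc_permutations :: "nat \<Rightarrow> (nat \<Rightarrow> nat) set" where
  "arc_permutations n =
     {\<pi>. \<pi> permutes {1..n} \<and> (\<forall>j. 1 \<le> j \<and> j \<le> n \<longrightarrow> cyclic_interval n (\<pi> ` {1..j}))}"

text \<open>
  The transposition is composed on the right, so it exchanges the letters in two adjacent
  positions.
\<close>

definition arc_graph :: "nat \<Rightarrow> (nat \<Rightarrow> nat, (nat \<Rightarrow> nat) \<times> (nat \<Rightarrow> nat)) pre_digraph" where
  "arc_graph n =
     \<lparr> verts = arc_permutations n,
       arcs = {(u, v). u \<in> arc_permutations n \<and> v \<in> arc_permutations n \<and>
                 (\<exists>i. 1 \<le> i \<and> i \<le> n - 1 \<and> u = v \<circ> transpose i (i + 1))},
       tail = fst, head = snd \<rparr>"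

definition reverse_perm :: "nat \<Rightarrow> nat \<Rightarrow> nat" where
  "reverse_perm n i = (if i \<in> {1..n} then n + 1 - i else i)"

lemma graph_arc_graph: "graph (arc_graph n)"
proof -
  let ?G = "arc_graph n"
  have fin: "finite (arc_permutations n)"
    by (rule finite_subset[OF _ finite_permutations[of "{1..n}"]])
      (auto simp: arc_permutations_def)
  have fin_arcs: "finite (arcs ?G)"
    by (rule finite_subset[OF _ finite_cartesian_product[OF fin fin]]) (auto simp: arc_graph_def)
  have loopfree: "u \<noteq> v" if "(u, v) \<in> arcs ?G" for u v
  proof
    assume "u = v"
    with that obtain i where v: "v permutes {1..n}" and eq: "v = v \<circ> transpose i (i + 1)"
      unfolding arc_graph_def arc_permutations_def by auto
    have "v i = v (i + 1)"
      using fun_cong[OF eq, of i] by (simp only: comp_apply transpose_apply_first)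
    then have "i = i + 1"
      by (rule injD[OF permutes_inj[OF v]])
    then show False
      by simp
  qed
  have symm: "(v, u) \<in> arcs ?G" if "(u, v) \<in> arcs ?G" for u v
  proof -
    from that obtain i where i: "1 \<le> i" "i \<le> n - 1" and eq: "u = v \<circ> transpose i (i + 1)"
      and uv: "u \<in> arc_permutations n" "v \<in> arc_permutations n"
      by (auto simp: arc_graph_def)
    have "v = u \<circ> transpose i (i + 1)"
      unfolding eq by (simp add: fun_eq_iff)
    with i uv show ?thesis
      by (auto simp: arc_graph_def)
  qed
  show ?thesis
  proof unfold_locales
    show "finite (verts ?G)" "finite (arcs ?G)"
      using fin fin_arcs by (simp_all add: arc_graph_def)
    show "symmetric ?G"
      unfolding symmetric_def arcs_ends_conv sym_def using symm by (auto simp: arc_graph_def)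
    show "tail ?G e \<in> verts ?G" "head ?G e \<in> verts ?G" if "e \<in> arcs ?G" for e
      using that by (auto simp: arc_graph_def)
    show "tail ?G e \<noteq> head ?G e" if "e \<in> arcs ?G" for e
      using loopfree[of "fst e" "snd e"] that by (simp add: arc_graph_def)
    show "e1 = e2" if "arc_to_ends ?G e1 = arc_to_ends ?G e2" for e1 e2
      using that by (simp add: arc_to_ends_def arc_graph_def prod_eq_iff)
  qed
qed

end

(*
  The sets of the first j letters (0 < j < n) of an arc permutation are cyclic intervals, each
  contained in the next.  Recording their left ends as integers l(1), ..., l(n-1) whose steps
  l(j) - l(j+1) are 0 or 1 gives a lattice path, unique up to adding a multiple of n to all entries.
  An edge of X_n changes a single entry by one, so the lattice paths form a covering of X_n (this
  needs n > 2), and their distance is the sum of |l(j) - l'(j)|.  The identity lifts to the constant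
  path 1, and its two nearest lifts of the reversal are the paths n+1-j and 1-j, both at distance
  n choose 2; geodesics of X_n are therefore the monotone walks to one of these two paths, which are
  exchanged by the reflection l(j) -> 2 - l(n-j).

  The paths between 1 and n+1-j correspond to the subsets S of {1..<n}, a step replacing some s in S
  by s-1 (and dropping it if this is 0).  The number of ways to reach the empty set is the number of
  shifted standard tableaux, (sum S)! / prod s! * prod (b-a)/(b+a).  That this satisfies the required
  recursion is, with y(s) = s(s-1) and a(s) = 2s, the partial fraction identity
  sum_s a(s) * prod_{j<>s} (1 - a(j)/(y(s)-y(j))) = sum_s a(s).
*)
theory Submission
  imports Defs
begin

section \<open>The product formula for strict partitions\<close>

text \<open>The full set of letters has no distinguished left end, so only the prefixes of length 1
  to n - 1 are recorded; the last letter is then forced. For n = 2 a path has a single entry, and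
  raising or lowering it by one gives the same permutation, so that walks would not lift uniquely.
  Geodesics of the two families are told apart by the end points of their lifts, so their numbers
  add up. The vertex sets do overlap: each family meets 2^(n-1) vertices, and a common vertex has
  lifts on both sides that differ by a shift, which happens only for the identity and the reversal;
  hence 2^n - 2. The diameter bound is an averaging argument: n - 1 positions with average gap at
  most n/2 give n choose 2. The numbers s(s-1) and 2s come from a quotient of weights. Lowering s
  turns the factor (s-j)/(s+j) of a pair into (s-1-j)/(s-1+j); the quotient (s-1-j)(s+j) /
  ((s-j)(s+j-1)) has denominator y(s) - y(j), and its numerator is smaller by a(j) = 2j.\<close>

lemma prod_one_minus_partial_fractions:
  fixes a y :: "'i \<Rightarrow> 'a :: field"
  assumes "finite S" "inj_on y S"
  defines "c \<equiv> \<lambda>S s. \<Prod>j\<in>S - {s}. 1 - a j / (y s - y j)"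
  shows "\<forall>x. x \<notin> y ` S \<longrightarrow>
           (\<Prod>j\<in>S. 1 - a j / (x - y j)) = 1 - (\<Sum>s\<in>S. a s * c S s / (x - y s))"
    and "(\<Sum>s\<in>S. a s * c S s) = sum a S"
proof -
  \<comment> \<open>The second claim compares the coefficients of 1/x at infinity in the first. One
    induction serves both: the coefficient of a new element \<open>t\<close> is the product over
    \<open>S\<close> at the point \<open>y t\<close>, which the first claim evaluates.\<close>
  have "(\<forall>x. x \<notin> y ` S \<longrightarrow>
           (\<Prod>j\<in>S. 1 - a j / (x - y j)) = 1 - (\<Sum>s\<in>S. a s * c S s / (x - y s))) \<and>
        (\<Sum>s\<in>S. a s * c S s) = sum a S"
    using assms(1,2)
  proof (induction S rule: finite_induct)
    case empty
    then show ?case by simp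
  next
    case (insert t S)
    have inj: "inj_on y S" and yt: "y t \<notin> y ` S"
      using insert.prems insert.hyps by auto
    note IH1 = insert.IH[OF inj, THEN conjunct1, rule_format]
      and IH2 = insert.IH[OF inj, THEN conjunct2]
    have cs: "c (insert t S) s = c S s * (1 - a t / (y s - y t))" if "s \<in> S" for s
    proof -
      have "insert t S - {s} = insert t (S - {s})"
        using that insert.hyps by auto
      then show ?thesis
        using insert.hyps by (simp add: c_def mult.commute)
    qed
    have ct: "c (insert t S) t = 1 - (\<Sum>s\<in>S. a s * c S s / (y t - y s))"
    proof -
      have "insert t S - {t} = S"
        using insert.hyps by auto
      then show ?thesis
        using IH1[OF yt] by (simp add: c_def)
    qed
    have ne: "y s - y t \<noteq> 0" if "s \<in> S" for s
      using yt that by (metis eq_iff_diff_eq_0 image_eqI)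
    have "(\<Sum>s\<in>insert t S. a s * c (insert t S) s) =
        a t * (1 - (\<Sum>s\<in>S. a s * c S s / (y t - y s))) + (\<Sum>s\<in>S. a s * (c S s * (1 - a t / (y s - y t))))"
      using insert.hyps cs ct by simp
    also have "\<dots> = a t + (\<Sum>s\<in>S. a s * (c S s * (1 - a t / (y s - y t))) - a t * (a s * c S s / (y t - y s)))"
      by (simp add: sum_subtractf sum_distrib_left right_diff_distrib)
    \<comment> \<open>The correction of the old coefficient at \<open>s\<close> and the
      \<open>s\<close>-term in the coefficient of \<open>t\<close> differ only in the sign of
      \<open>y s - y t\<close>, so they cancel.\<close>
    also have "(\<Sum>s\<in>S. a s * (c S s * (1 - a t / (y s - y t))) - a t * (a s * c S s / (y t - y s)))
        = (\<Sum>s\<in>S. a s * c S s)"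
    proof (rule sum.cong[OF refl])
      fix s assume "s \<in> S"
      have "a t * (a s * c S s / (y t - y s)) = - (a t * (a s * c S s) / (y s - y t))"
        by (metis minus_diff_eq minus_divide_right times_divide_eq_right)
      then show "a s * (c S s * (1 - a t / (y s - y t))) - a t * (a s * c S s / (y t - y s)) = a s * c S s"
        by (simp add: algebra_simps)
    qed
    finally have Q: "(\<Sum>s\<in>insert t S. a s * c (insert t S) s) = sum a (insert t S)"
      using IH2 insert.hyps by simp
    have P: "(\<Prod>j\<in>insert t S. 1 - a j / (x - y j)) =
        1 - (\<Sum>s\<in>insert t S. a s * c (insert t S) s / (x - y s))" if x: "x \<notin> y ` insert t S" for x
    proof -
      have xt: "x - y t \<noteq> 0" and xs: "\<And>s. s \<in> S \<Longrightarrow> x - y s \<noteq> 0" and xS: "x \<notin> y ` S"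
        using x by auto
      have termwise: "a s * (c S s * (1 - a t / (y s - y t))) / (x - y s)
          - a t * (a s * c S s / (y t - y s)) / (x - y t)
          = (1 - a t / (x - y t)) * (a s * c S s / (x - y s))" if s: "s \<in> S" for s
      proof -
        \<comment> \<open>Read \<open>p\<close> as \<open>x - y s\<close> and \<open>r\<close> as
          \<open>y s - y t\<close>, so that \<open>p + r\<close> is \<open>x - y t\<close>.\<close>
        have "k * (1 - b / r) / p - b * (k / (- r)) / (p + r) = (1 - b / (p + r)) * (k / p)"
          if "p \<noteq> 0" "r \<noteq> 0" "p + r \<noteq> 0" for k b p r :: 'a
        proof -
          have "k * (1 - b / r) / p - b * (k / (- r)) / (p + r) =
              k / p - b * k * (1 / (r * p) - 1 / (r * (p + r)))"
            by (simp add: right_diff_distrib diff_divide_distrib mult.commute)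
          also have "1 / (r * p) - 1 / (r * (p + r)) = 1 / (p * (p + r))"
            using that by (simp add: divide_simps)
          finally show ?thesis
            by (simp add: right_diff_distrib diff_divide_distrib mult_ac)
        qed
        from this[of "x - y s" "y s - y t" "a s * c S s" "a t"] show ?thesis
          using xt xs[OF s] ne[OF s] by (simp add: mult.assoc)
      qed
      have "(\<Sum>s\<in>insert t S. a s * c (insert t S) s / (x - y s)) =
         a t * (1 - (\<Sum>s\<in>S. a s * c S s / (y t - y s))) / (x - y t)
           + (\<Sum>s\<in>S. a s * (c S s * (1 - a t / (y s - y t))) / (x - y s))"
        using insert.hyps cs ct by simp
      also have "\<dots> = a t / (x - y t) + (\<Sum>s\<in>S. a s * (c S s * (1 - a t / (y s - y t))) / (x - y s)
          - a t * (a s * c S s / (y t - y s)) / (x - y t))"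
        by (simp add: sum_subtractf sum_distrib_left sum_divide_distrib right_diff_distrib diff_divide_distrib)
      also have "\<dots> = a t / (x - y t) + (\<Sum>s\<in>S. (1 - a t / (x - y t)) * (a s * c S s / (x - y s)))"
        using termwise by simp
      also have "\<dots> = a t / (x - y t) + (1 - a t / (x - y t)) * (1 - (\<Prod>j\<in>S. 1 - a j / (x - y j)))"
        using IH1[OF xS] by (simp add: sum_distrib_left)
      also have "\<dots> = 1 - (\<Prod>j\<in>insert t S. 1 - a j / (x - y j))"
        using insert.hyps by (simp add: algebra_simps)
      finally show ?thesis by simp
    qed
    show ?case using P Q by blast
  qed
  then show "\<forall>x. x \<notin> y ` S \<longrightarrow>
           (\<Prod>j\<in>S. 1 - a j / (x - y j)) = 1 - (\<Sum>s\<in>S. a s * c S s / (x - y s))"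
    and "(\<Sum>s\<in>S. a s * c S s) = sum a S"
    by blast+
qed

section \<open>Weights of strict partitions when one part is lowered\<close>

definition strict_weight :: "nat set \<Rightarrow> real" where
  "strict_weight S =
     (\<Prod>s\<in>S. (\<Prod>a\<in>{a\<in>S. a < s}. (real s - real a) / (real s + real a)) / fact s)"

text \<open>Every unordered pair contributes one factor, larger element first. The absolute value
  makes this independent of the side on which \<open>t\<close> lies, so a part can be exchanged
  anywhere in the set.\<close>

lemma strict_weight_insert:
  assumes "finite R" "t \<notin> R"
  shows "strict_weight (insert t R) =
           strict_weight R * (\<Prod>j\<in>R. \<bar>real t - real j\<bar> / (real t + real j)) / fact t"
proof -
  let ?f = "\<lambda>b a. (real b - real a) / (real b + real a)"
  have t: "{a \<in> insert t R. a < t} = {a \<in> R. a < t}" by auto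
  have s: "(\<Prod>a\<in>{a \<in> insert t R. a < s}. ?f s a) =
      (if t < s then ?f s t else 1) * (\<Prod>a\<in>{a \<in> R. a < s}. ?f s a)" for s
  proof (cases "t < s")
    case True
    then have "{a \<in> insert t R. a < s} = insert t {a \<in> R. a < s}" by auto
    then show ?thesis using assms True by simp
  next
    case False
    then have "{a \<in> insert t R. a < s} = {a \<in> R. a < s}" by auto
    then show ?thesis using False by simp
  qed
  have "(\<Prod>j\<in>R. \<bar>real t - real j\<bar> / (real t + real j)) =
     (\<Prod>j\<in>R. (if j < t then ?f t j else 1) * (if t < j then ?f j t else 1))"
  proof (rule prod.cong[OF refl])
    fix j assume "j \<in> R"
    then have "j < t \<or> t < j"
      using assms(2) by (metis nat_neq_iff)
    then show "\<bar>real t - real j\<bar> / (real t + real j) =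
        (if j < t then ?f t j else 1) * (if t < j then ?f j t else 1)"
      by (auto simp: add.commute)
  qed
  also have "\<dots> = (\<Prod>j\<in>{a \<in> R. a < t}. ?f t j) * (\<Prod>j\<in>R. (if t < j then ?f j t else 1))"
    using assms(1) by (simp add: prod.distrib prod.inter_filter)
  finally show ?thesis
    using assms
    unfolding strict_weight_def prod.insert[OF assms] t s prod.distrib
    by (simp add: prod.distrib prod_dividef mult_ac)
qed

definition lower_part :: "nat set \<Rightarrow> nat \<Rightarrow> nat set" where
  "lower_part S s = (S - {s}) \<union> ({s - 1} - {0})"

definition strict_count :: "nat set \<Rightarrow> real" where
  "strict_count S = fact (\<Sum>S) * strict_weight S"

text \<open>A forbidden move needs no separate treatment: for \<open>j = s - 1\<close> the
  denominator on the right equals \<open>2 * j\<close>, so that factor is 0, in agreement with the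
  \<open>if\<close>.\<close>

lemma strict_weight_lower_part:
  assumes S: "finite S" "s \<in> S" "0 \<notin> S"
  shows "(if s - 1 \<in> S then 0 else strict_weight (lower_part S s)) = strict_weight S * real s *
    (\<Prod>j\<in>S - {s}. 1 - 2 * real j / (real s * (real s - 1) - real j * (real j - 1)))"
proof -
  define R where "R = S - {s}"
  have R: "finite R" "s \<notin> R" "0 \<notin> R" "S = insert s R"
    using S by (auto simp: R_def)
  have s0: "s > 0"
    using S by (metis gr0I)
  have "(if s - 1 \<in> S then 0 else strict_weight (lower_part S s)) =
      strict_weight R * (\<Prod>j\<in>R. \<bar>real (s - 1) - real j\<bar> / (real (s - 1) + real j)) / fact (s - 1)"
  proof -
    \<comment> \<open>A collision makes a factor zero. For \<open>s = 1\<close> the part disappears,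
      which fits the formula because every factor is then \<open>j / j\<close> and
      \<open>fact 0 = 1\<close>.\<close>
    consider "s - 1 \<in> R" | "s - 1 \<notin> R" "s = 1" | "s - 1 \<notin> R" "s > 1"
      using s0 by linarith
    then show ?thesis
    proof cases
      case 1
      then have "(\<Prod>j\<in>R. \<bar>real (s - 1) - real j\<bar> / (real (s - 1) + real j)) = 0"
        using R(1) by (intro prod_zero bexI[of _ "s - 1"]) simp_all
      then show ?thesis using 1 R(4) by simp
    next
      case 2
      have "(\<Prod>j\<in>R. \<bar>real (s - 1) - real j\<bar> / (real (s - 1) + real j)) = 1"
      proof (intro prod.neutral ballI)
        fix j assume "j \<in> R"
        then have "real j \<noteq> 0" using R(3) by (metis of_nat_eq_0_iff)
        then show "\<bar>real (s - 1) - real j\<bar> / (real (s - 1) + real j) = 1"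
          using 2 by simp
      qed
      moreover have "lower_part S s = R" "s - 1 \<notin> S"
        using 2(2) S(3) unfolding lower_part_def R_def by simp_all
      ultimately show ?thesis using 2 by simp
    next
      case 3
      have "lower_part S s = insert (s - 1) R"
        using 3(2) unfolding lower_part_def R_def by simp
      moreover have "s - 1 \<notin> S" using 3 R(4) by auto
      ultimately show ?thesis
        using 3 strict_weight_insert[OF R(1) 3(1)] by simp
    qed
  qed
  also have "(\<Prod>j\<in>R. \<bar>real (s - 1) - real j\<bar> / (real (s - 1) + real j)) =
     (\<Prod>j\<in>R. \<bar>real s - real j\<bar> / (real s + real j) *
        (1 - 2 * real j / (real s * (real s - 1) - real j * (real j - 1))))"
  proof (rule prod.cong[OF refl])
    fix j assume "j \<in> R"
    then have j: "j \<noteq> s" "j > 0" using R(2,3) by (metis gr0I)+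
    define x y where "x = real s" "y = real j"
    have xy: "x \<ge> 1" "y \<ge> 1" "x \<noteq> y" "x + 1 \<le> y \<or> y + 1 \<le> x"
      using s0 j by (auto simp: x_y_def)
    have d: "x * (x - 1) - y * (y - 1) = (x - y) * (x + y - 1)"
      by (simp add: algebra_simps)
    have nz: "x - y \<noteq> 0" "x + y - 1 \<noteq> 0" "x + y \<noteq> 0" using xy by auto
    have e: "(x - y) * (x + y - 1) - 2 * y = (x - 1 - y) * (x + y)"
      by (simp add: algebra_simps)
    have "1 - 2 * y / ((x - y) * (x + y - 1)) = (x - 1 - y) * (x + y) / ((x - y) * (x + y - 1))"
      unfolding e[symmetric] using nz by (simp add: diff_divide_distrib)
    then have "\<bar>x - y\<bar> / (x + y) * (1 - 2 * y / ((x - y) * (x + y - 1))) =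
        \<bar>x - y\<bar> * (x - 1 - y) / ((x - y) * (x + y - 1))"
      using nz by (simp only:) simp
    \<comment> \<open>Distinct integers differ by at least one, so \<open>x - y\<close> and
      \<open>x - 1 - y\<close> never have opposite signs.\<close>
    also have "\<bar>x - y\<bar> * (x - 1 - y) = \<bar>x - 1 - y\<bar> * (x - y)"
      using xy(4) by (cases "x + 1 \<le> y") (simp_all add: abs_if algebra_simps)
    also have "\<bar>x - 1 - y\<bar> * (x - y) / ((x - y) * (x + y - 1)) = \<bar>x - 1 - y\<bar> / (x - 1 + y)"
      using nz by (simp add: add.commute add_diff_eq)
    finally have "\<bar>x - 1 - y\<bar> / (x - 1 + y) =
        \<bar>x - y\<bar> / (x + y) * (1 - 2 * y / (x * (x - 1) - y * (y - 1)))"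
      by (simp only: d)
    then show "\<bar>real (s - 1) - real j\<bar> / (real (s - 1) + real j) = \<bar>real s - real j\<bar> / (real s + real j) *
        (1 - 2 * real j / (real s * (real s - 1) - real j * (real j - 1)))"
      using s0 by (simp add: x_y_def of_nat_diff)
  qed
  finally show ?thesis
    unfolding R_def[symmetric] strict_weight_insert[OF R(1,2), folded R(4)] prod.distrib
    using fact_reduce[OF s0, where 'a = real] s0 by simp
qed

lemma sum_lower_part:
  assumes "finite S" "s \<in> S" "s - 1 \<notin> S" "0 \<notin> S"
  shows "\<Sum>(lower_part S s) = \<Sum>S - 1"
proof -
  have "\<Sum>S = s + \<Sum>(S - {s})"
    using assms by (simp add: sum.remove)
  moreover have "s > 0" using assms by (auto intro: gr0I)
  moreover have "\<Sum>(lower_part S s) = \<Sum>(S - {s}) + (s - 1)"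
  proof (cases "s = 1")
    case False
    then have "lower_part S s = insert (s - 1) (S - {s})"
      using \<open>s > 0\<close> by (auto simp: lower_part_def)
    then show ?thesis
      using assms by simp
  qed (simp add: lower_part_def)
  ultimately show ?thesis by simp
qed

lemma strict_count_rec:
  assumes S: "finite S" "0 \<notin> S" "S \<noteq> {}"
  shows "strict_count S = (\<Sum>s | s \<in> S \<and> s - 1 \<notin> S. strict_count (lower_part S s))"
proof -
  \<comment> \<open>Positivity of the parts matters here: j(j-1) takes the same value at 0 and
    1.\<close>
  have inj: "inj_on (\<lambda>j. real j * (real j - 1)) S"
  proof (rule inj_onI)
    fix x y assume xy: "x \<in> S" "y \<in> S" "real x * (real x - 1) = real y * (real y - 1)"
    then have "x \<ge> 1" "y \<ge> 1" using S by (auto simp: Suc_le_eq intro: gr0I)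
    moreover have "(real x - real y) * (real x + real y - 1) = 0"
      using xy(3) by (simp add: algebra_simps)
    ultimately show "x = y" by auto
  qed
  have N: "\<Sum>S > 0"
    using S by (metis gr0I sum_eq_0_iff all_not_in_conv)
  have "(\<Sum>s | s \<in> S \<and> s - 1 \<notin> S. strict_count (lower_part S s)) =
      (\<Sum>s | s \<in> S \<and> s - 1 \<notin> S. fact (\<Sum>S - 1) * strict_weight (lower_part S s))"
    using S by (intro sum.cong) (auto simp: strict_count_def sum_lower_part)
  \<comment> \<open>The forbidden moves are added as zeros, because the partial fraction identity
    sums over all of \<open>S\<close>.\<close>
  also have "\<dots> = (\<Sum>s\<in>S. fact (\<Sum>S - 1) * (if s - 1 \<in> S then 0 else strict_weight (lower_part S s)))"
    using S(1) by (intro sum.mono_neutral_cong_left) auto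
  also have "\<dots> = fact (\<Sum>S - 1) * strict_weight S * (\<Sum>s\<in>S. 2 * real s *
    (\<Prod>j\<in>S - {s}. 1 - 2 * real j / (real s * (real s - 1) - real j * (real j - 1)))) / 2"
    unfolding sum_distrib_left sum_divide_distrib
  proof (rule sum.cong[OF refl])
    fix s assume "s \<in> S"
    from strict_weight_lower_part[OF S(1) this S(2)]
    show "fact (\<Sum>S - 1) * (if s - 1 \<in> S then 0 else strict_weight (lower_part S s)) =
        fact (\<Sum>S - 1) * strict_weight S * (2 * real s *
    (\<Prod>j\<in>S - {s}. 1 - 2 * real j / (real s * (real s - 1) - real j * (real j - 1)))) / 2"
      by (simp only:)
  qed
  also have "\<dots> = fact (\<Sum>S - 1) * strict_weight S * real (\<Sum>S)"
    using prod_one_minus_partial_fractions(2)[OF S(1) inj, of "\<lambda>j. 2 * real j"]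
    by (simp add: sum_distrib_left[symmetric])
  also have "\<dots> = strict_count S"
    using N by (simp add: strict_count_def fact_reduce)
  finally show ?thesis by simp
qed

lemma strict_weight_staircase:
  "strict_weight {1..<Suc m} = (\<Prod>i<m. fact i / fact (2 * i + 1))"
proof (induction m)
  case 0
  then show ?case by (simp add: strict_weight_def)
next
  case (Suc m)
  \<comment> \<open>The numerators fall from \<open>m\<close> and the denominators rise from
    \<open>m + 2\<close>, which gives quotients of factorials. At \<open>k = m\<close> the factor
    \<open>fact (Suc m)\<close> cancels against the one in the weight of the new part
    \<open>Suc m\<close>.\<close>
  have partial: "(\<Prod>j = 1..<Suc k. \<bar>real (Suc m) - real j\<bar> / (real (Suc m) + real j)) =
      fact m * fact (Suc m) / (fact (m - k) * fact (Suc m + k))" if "k \<le> m" for k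
    using that
  proof (induction k)
    case (Suc k)
    then have f: "fact (m - k) = real (m - k) * fact (m - Suc k)"
      by (metis Suc_diff_Suc Suc_le_lessD fact_Suc of_nat_mult of_nat_fact)
    have k: "real (m - k) > 0" and r: "real (Suc m) - real (Suc k) = real (m - k)"
      using Suc.prems by auto
    have "(\<Prod>j = 1..<Suc (Suc k). \<bar>real (Suc m) - real j\<bar> / (real (Suc m) + real j)) =
        fact m * fact (Suc m) / (fact (m - k) * fact (Suc m + k)) *
        (real (m - k) / real (Suc m + Suc k))"
      using Suc r by (simp add: prod.op_ivl_Suc)
    also have "\<dots> = fact m * fact (Suc m) / (fact (m - Suc k) * fact (Suc m + Suc k))"
    proof -
      have g: "fact (Suc m + Suc k) = real (Suc m + Suc k) * fact (Suc m + k)"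
        by (simp del: of_nat_Suc)
      show ?thesis
        unfolding f g using k by (simp del: of_nat_Suc fact_Suc of_nat_diff)
    qed
    finally show ?case .
  qed simp
  have "Suc m + m = 2 * m + 1" by simp
  with partial[OF order_refl]
  have p: "(\<Prod>j = 1..<Suc m. \<bar>real (Suc m) - real j\<bar> / (real (Suc m) + real j)) =
      fact m * fact (Suc m) / fact (2 * m + 1)"
    by (simp only: diff_self_eq_0 fact_0 mult_1)
  have i: "{1..<Suc (Suc m)} = insert (Suc m) {1..<Suc m}" by auto
  have "strict_weight {1..<Suc (Suc m)} =
      strict_weight {1..<Suc m} * (fact m * fact (Suc m) / fact (2 * m + 1)) / fact (Suc m)"
    unfolding i p[symmetric] by (rule strict_weight_insert) auto
  also have "\<dots> = (\<Prod>i<m. fact i / fact (2 * i + 1)) * (fact m / fact (2 * m + 1))"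
    unfolding Suc by (simp del: fact_Suc)
  finally show ?case by (simp del: fact_Suc)
qed

section \<open>Cyclic intervals\<close>

text \<open>Representatives run from 1 to n instead of 0 to n - 1, hence the shift by one before and
  after \<open>mod\<close>.\<close>

definition residue :: "nat \<Rightarrow> int \<Rightarrow> nat" where
  "residue n z = Suc (nat ((z - 1) mod int n))"

text \<open>The left end is an arbitrary integer, so growing to either side is plain arithmetic and
  wrapping around is left to \<open>residue\<close>.\<close>

definition cyc :: "nat \<Rightarrow> int \<Rightarrow> nat \<Rightarrow> nat set" where
  "cyc n a k = residue n ` {a..<a + int k}"

context
  fixes n :: nat
  assumes n_pos: "n > 0"
begin

lemma residue_range: "residue n z \<in> {1..n}"
proof -
  have "0 \<le> (z - 1) mod int n" "(z - 1) mod int n < int n"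
    using n_pos by simp_all
  then show ?thesis
    by (auto simp: residue_def nat_less_iff Suc_le_eq)
qed

lemma residue_eq_iff: "residue n x = residue n y \<longleftrightarrow> int n dvd x - y"
proof -
  have "residue n x = residue n y \<longleftrightarrow> (x - 1) mod int n = (y - 1) mod int n"
    using n_pos by (auto simp: residue_def nat_eq_iff)
  also have "\<dots> \<longleftrightarrow> int n dvd (x - 1) - (y - 1)"
    by (rule mod_eq_dvd_iff)
  finally show ?thesis by simp
qed

lemma residue_of_nat: "x \<in> {1..n} \<Longrightarrow> residue n (int x) = x"
  by (auto simp: residue_def nat_eq_iff)

lemma residue_in_cyc_iff: "residue n x \<in> cyc n a k \<longleftrightarrow> (\<exists>t. 0 \<le> t \<and> t < int k \<and> int n dvd x - (a + t))"
proof
  assume "residue n x \<in> cyc n a k"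
  then obtain z where "z \<in> {a..<a + int k}" "residue n x = residue n z"
    by (auto simp: cyc_def)
  then show "\<exists>t. 0 \<le> t \<and> t < int k \<and> int n dvd x - (a + t)"
    by (intro exI[of _ "z - a"]) (auto simp: residue_eq_iff)
next
  assume "\<exists>t. 0 \<le> t \<and> t < int k \<and> int n dvd x - (a + t)"
  then obtain t where "0 \<le> t" "t < int k" "residue n x = residue n (a + t)"
    by (auto simp: residue_eq_iff)
  then show "residue n x \<in> cyc n a k"
    by (auto simp: cyc_def)
qed

lemma small_multiple: "int n dvd z \<Longrightarrow> - int n < z \<Longrightarrow> z < int n \<Longrightarrow> z = 0"
  by (metis abs_less_iff dvd_imp_le_int linorder_not_less minus_less_iff abs_of_nat)

lemma card_cyc:
  assumes "k \<le> n"
  shows "card (cyc n a k) = k"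
proof -
  have "inj_on (residue n) {a..<a + int k}"
  proof (rule inj_onI)
    fix x y assume xy: "x \<in> {a..<a + int k}" "y \<in> {a..<a + int k}" "residue n x = residue n y"
    then have "int n dvd x - y" by (simp add: residue_eq_iff)
    moreover have "- int n < x - y" "x - y < int n" using xy assms by auto
    ultimately have "x - y = 0" by (rule small_multiple)
    then show "x = y" by simp
  qed
  then show ?thesis by (simp add: cyc_def card_image)
qed

lemma cyc_subset: "cyc n a k \<subseteq> {1..n}"
  using residue_range by (auto simp only: cyc_def)

lemma cyc_full: "cyc n a n = {1..n}"
  by (intro card_subset_eq finite_atLeastAtMost cyc_subset) (simp add: card_cyc)

lemma cyc_Suc_right: "cyc n a (Suc k) = insert (residue n (a + int k)) (cyc n a k)"
proof -
  have "{a..<a + int (Suc k)} = insert (a + int k) {a..<a + int k}" by auto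
  then show ?thesis by (simp only: cyc_def image_insert)
qed

lemma cyc_Suc_left: "cyc n (a - 1) (Suc k) = insert (residue n (a - 1)) (cyc n a k)"
proof -
  have "{a - 1..<a - 1 + int (Suc k)} = insert (a - 1) {a..<a + int k}" by auto
  then show ?thesis by (simp only: cyc_def image_insert)
qed

lemma cyc_cong:
  assumes "int n dvd a - b"
  shows "cyc n a k = cyc n b k"
proof -
  have "cyc n a k \<subseteq> cyc n b k" if "int n dvd a - b" for a b
  proof
    fix x assume "x \<in> cyc n a k"
    then obtain z where z: "x = residue n z" "a \<le> z" "z < a + int k"
      by (auto simp: cyc_def)
    have "residue n z = residue n (z - a + b)"
      using that by (simp add: residue_eq_iff)
    then show "x \<in> cyc n b k"
      using z by (auto simp: cyc_def)
  qed
  moreover have "int n dvd b - a" using assms by (metis dvd_minus_iff minus_diff_eq)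
  ultimately show ?thesis using assms by blast
qed

lemma cyc_inclusion_step:
  assumes "1 \<le> k" "Suc k < n" "cyc n a k \<subseteq> cyc n b (Suc k)"
  shows "int n dvd a - b \<or> int n dvd a - 1 - b"
proof -
  have "residue n a \<in> cyc n a k"
    using assms(1) by (auto simp: cyc_def)
  then obtain t where t: "0 \<le> t" "t < int (Suc k)" "int n dvd a - (b + t)"
    using assms(3) residue_in_cyc_iff by blast
  have "t < 2"
  proof (rule ccontr)
    assume "\<not> t < 2"
    \<comment> \<open>If \<open>a\<close> sits at offset \<open>t \<ge> 2\<close> in the larger
      interval, this element sits at offset \<open>k + 1\<close>, just past its right end; as
      \<open>Suc k < n\<close>, it has not wrapped around to the left end.\<close>
    have "residue n (a + (int k + 1 - t)) \<in> cyc n a k"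
      using t \<open>\<not> t < 2\<close> by (auto simp: cyc_def)
    then obtain s where s: "0 \<le> s" "s < int (Suc k)" "int n dvd a + (int k + 1 - t) - (b + s)"
      using assms(3) residue_in_cyc_iff by blast
    have "int n dvd (a + (int k + 1 - t) - (b + s)) - (a - (b + t))"
      using s(3) t(3) by (rule dvd_diff)
    also have "(a + (int k + 1 - t) - (b + s)) - (a - (b + t)) = int k + 1 - s" by simp
    finally have "int k + 1 - s = 0"
      using s assms(2) by (intro small_multiple) auto
    then show False using s by simp
  qed
  then have "t = 0 \<or> t = 1" using t(1) by auto
  then show ?thesis using t(3) by (auto simp: algebra_simps)
qed

text \<open>The left end is intrinsic to a proper arc: it is the only element whose predecessor lies
  outside. This fails for the full circle, hence \<open>k < n\<close>.\<close>

lemma cyc_eq_imp_dvd: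
  assumes "1 \<le> k" "k < n" "cyc n a k = cyc n b k"
  shows "int n dvd a - b"
proof -
  have "residue n a \<in> cyc n a k"
    using assms(1) by (auto simp: cyc_def)
  then obtain t where t: "0 \<le> t" "t < int k" "int n dvd a - (b + t)"
    using assms(3) residue_in_cyc_iff by blast
  have "t = 0"
  proof (rule ccontr)
    assume "t \<noteq> 0"
    have "int n dvd a - 1 - (b + (t - 1))"
      using t(3) by (simp add: algebra_simps)
    then have "residue n (a - 1) \<in> cyc n b k"
      unfolding residue_in_cyc_iff
      using t(1,2) \<open>t \<noteq> 0\<close> by (intro exI[of _ "t - 1"]) simp
    then obtain s where s: "0 \<le> s" "s < int k" "int n dvd a - 1 - (a + s)"
      using assms(3) residue_in_cyc_iff by blast
    have "a - 1 - (a + s) = 0"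
      using s assms(2) by (intro small_multiple) auto
    then show False using s by simp
  qed
  then show ?thesis using t by simp
qed

lemma cyc_eq_Icc:
  assumes "1 \<le> a" "a \<le> b" "b \<le> n"
  shows "cyc n (int a) (Suc b - a) = {a..b}"
proof -
  have "{int a..<int a + int (Suc b - a)} = int ` {a..b}"
    using assms by (simp only: image_int_atLeastAtMost) auto
  then have "cyc n (int a) (Suc b - a) = (\<lambda>x. residue n (int x)) ` {a..b}"
    by (simp only: cyc_def image_image)
  also have "\<dots> = (\<lambda>x. x) ` {a..b}"
    using assms by (intro image_cong refl residue_of_nat) auto
  finally show ?thesis by simp
qed

lemma cyclic_interval_iff_cyc:
  assumes "1 \<le> k" "k < n"
  shows "cyclic_interval n S \<and> card S = k \<longleftrightarrow> (\<exists>a. S = cyc n a k)"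
proof
  \<comment> \<open>Unrolled, the piece from 1 to \<open>a\<close> consists of the integers from
    \<open>n + 1\<close> to \<open>n + a\<close>.\<close>
  have wrap: "cyc n (int b) (Suc n - b + a) = {b..n} \<union> {1..a}" if "1 \<le> b" "b \<le> n" "a \<le> n" for a b
  proof -
    have "{int b..<int b + int (Suc n - b + a)} = {int b..<int b + int (Suc n - b)} \<union> {1 + int n..<1 + int n + int a}"
      using that by auto
    then have "cyc n (int b) (Suc n - b + a) = cyc n (int b) (Suc n - b) \<union> cyc n (1 + int n) a"
      by (simp only: cyc_def image_Un)
    also have "cyc n (1 + int n) a = cyc n (int 1) (Suc a - 1)"
      by (simp add: cyc_cong)
    finally show ?thesis
      using cyc_eq_Icc[of b n] cyc_eq_Icc[of 1 a] that by (cases "a = 0") (simp_all add: cyc_def)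
  qed
  show "\<exists>a. S = cyc n a k" if S: "cyclic_interval n S \<and> card S = k"
  proof -
    from S obtain a b where ab: "1 \<le> a" "a \<le> b" "b \<le> n" "S = {a..b} \<or> S = {b..n} \<union> {1..a}"
      unfolding cyclic_interval_def by blast
    show ?thesis
    proof (cases "S = {a..b}")
      case True
      then have "k = Suc b - a" using S by simp
      then show ?thesis using True cyc_eq_Icc ab by blast
    next
      case False
      then have S': "S = {b..n} \<union> {1..a}" using ab by blast
      \<comment> \<open>The two pieces overlap only for \<open>a = b\<close>, and then they cover
        everything.\<close>
      have "a \<noteq> b"
      proof
        assume "a = b"
        then have "S = {1..n}" using S' ab by auto
        then show False using S assms by simp
      qed
      then have "{b..n} \<inter> {1..a} = {}" using ab by auto
      then have "k = Suc n - b + a" using S S' by (simp add: card_Un_disjoint)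
      then show ?thesis using S' wrap[of b a] ab by auto
    qed
  qed
  show "cyclic_interval n S \<and> card S = k" if "\<exists>a. S = cyc n a k"
  proof -
    from that obtain a where a: "S = cyc n a k" ..
    define b where "b = residue n a"
    have b: "1 \<le> b" "b \<le> n" using residue_range[of a] by (auto simp: b_def)
    then have "int n dvd int b - a"
      using residue_of_nat[of b] by (simp add: residue_eq_iff[symmetric] b_def)
    then have S: "S = cyc n (int b) k" using a cyc_cong by metis
    have "cyclic_interval n S"
    proof (cases "b + k \<le> Suc n")
      case True
      then have "S = {b..b + k - 1}"
        using cyc_eq_Icc[of b "b + k - 1"] b assms S by (simp add: Suc_diff_le)
      then show ?thesis
        unfolding cyclic_interval_def using True b assms
        by (intro exI[of _ b] exI[of _ "b + k - 1"]) auto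
    next
      case False
      then have "S = {b..n} \<union> {1..b + k - Suc n}"
        using wrap[of b "b + k - Suc n"] b assms S by simp
      then show ?thesis
        unfolding cyclic_interval_def using False b assms
        by (intro exI[of _ "b + k - Suc n"] exI[of _ b]) auto
    qed
    then show ?thesis using a card_cyc assms by simp
  qed
qed

end

section \<open>Lattice paths as a covering of the graph of arc permutations\<close>

text \<open>The letter at position \<open>j\<close> is what the prefix of length \<open>j\<close>
  adds to the previous one.\<close>

lemma permutes_eq_if_prefix_images_eq:
  fixes u v :: "nat \<Rightarrow> nat"
  assumes u: "u permutes {1..n}" and v: "v permutes {1..n}"
    and uv: "\<And>j. j \<in> {1..<n} \<Longrightarrow> u ` {1..j} = v ` {1..j}"
  shows "u = v"
proof
  fix j
  have pre: "u ` {1..m} = v ` {1..m}" if "m \<le> n" for m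
  proof -
    have "m = 0 \<or> m \<in> {1..<n} \<or> m = n" using that by auto
    then show ?thesis
      using uv permutes_image[OF u] permutes_image[OF v] by auto
  qed
  show "u j = v j"
  proof (cases "j \<in> {1..n}")
    case True
    then have j: "{1..j} - {1..j - 1} = {j}" "j \<le> n" "j - 1 \<le> n" by auto
    have "w ` {1..j} - w ` {1..j - 1} = {w j}" if "w permutes {1..n}" for w
      using image_set_diff[OF permutes_inj[OF that], of "{1..j}" "{1..j - 1}"] j by simp
    from this[OF u] this[OF v] show ?thesis
      using pre[OF j(2)] pre[OF j(3)] by simp
  next
    case False
    then show ?thesis using u v by (simp add: permutes_not_in)
  qed
qed

text \<open>The prefixes of length \<open>i - 1\<close> and \<open>i + 1\<close> agree, so both
  words carry the same two letters at positions \<open>i\<close> and \<open>i + 1\<close>; different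
  words must have them in opposite order.\<close>

lemma permutes_transpose_if_prefix_images_eq:
  fixes u v :: "nat \<Rightarrow> nat"
  assumes u: "u permutes {1..n}" and v: "v permutes {1..n}" and i: "i \<in> {1..<n}"
    and uv: "\<And>j. j \<in> {1..<n} \<Longrightarrow> j \<noteq> i \<Longrightarrow> u ` {1..j} = v ` {1..j}"
    and ne: "u \<noteq> v"
  shows "u = v \<circ> transpose i (i + 1)"
proof (rule permutes_eq_if_prefix_images_eq[OF u])
  let ?s = "transpose i (i + 1)"
  have "?s permutes {1..n}" using i by (intro permutes_swap_id) auto
  then show p: "v \<circ> ?s permutes {1..n}" using v by (rule permutes_compose)
  have s: "?s ` {1..j} = {1..j}" if "j \<noteq> i" for j
    using that i by (cases "j < i") (auto simp: transpose_def image_iff)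
  fix j assume j: "j \<in> {1..<n}"
  show "u ` {1..j} = (v \<circ> ?s) ` {1..j}"
  proof (cases "j = i")
    case False
    then have "v ` {1..j} = v ` ?s ` {1..j}" using s by simp
    then show ?thesis using uv[OF j False] by (simp only: image_comp)
  next
    case True
    have pre: "u ` {1..m} = v ` {1..m}" if "m \<le> n" "m \<noteq> i" for m
    proof -
      have "m = 0 \<or> m \<in> {1..<n} \<or> m = n" using that by auto
      then show ?thesis
        using uv permutes_image[OF u] permutes_image[OF v] that by auto
    qed
    have "w ` {i, i + 1} = w ` {1..i + 1} - w ` {1..i - 1}" if "w permutes {1..n}" for w
    proof -
      have "{i, i + 1} = {1..i + 1} - {1..i - 1}" using i by auto
      then show ?thesis by (simp only: image_set_diff[OF permutes_inj[OF that]])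
    qed
    moreover have pre_i: "u ` {1..i + 1} = v ` {1..i + 1}" "u ` {1..i - 1} = v ` {1..i - 1}"
      by (rule pre; use i in auto)+
    ultimately have ends: "u ` {i, i + 1} = v ` {i, i + 1}"
      using u v by metis
    have ins: "{1..i} = insert i {1..i - 1}" using i by auto
    have "u i \<noteq> v i"
    proof
      assume a: "u i = v i"
      have "u ` {1..i} = v ` {1..i}"
        unfolding ins image_insert a pre_i ..
      then have "u ` {1..j} = v ` {1..j}" if "j \<in> {1..<n}" for j
        using uv[OF that] by (cases "j = i") simp_all
      then have "u = v"
        by (rule permutes_eq_if_prefix_images_eq[OF u v])
      then show False using ne by simp
    qed
    then have "u i = v (i + 1)" using ends by auto
    moreover have "(v \<circ> ?s) ` {1..i - 1} = v ` ?s ` {1..i - 1}"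
      by (simp only: image_comp)
    moreover have "?s ` {1..i - 1} = {1..i - 1}" by (rule s) (use i in auto)
    ultimately show ?thesis
      unfolding True ins image_insert using pre_i by simp
  qed
qed

text \<open>Entries outside the relevant positions are pinned to 0, so that equality of functions is
  equality of paths.\<close>

definition lattice_path :: "nat \<Rightarrow> (nat \<Rightarrow> int) \<Rightarrow> bool" where
  "lattice_path n l \<longleftrightarrow>
     (\<forall>i. 1 \<le> i \<and> Suc i < n \<longrightarrow> l i = l (Suc i) \<or> l i = l (Suc i) + 1) \<and>
     (\<forall>i. i \<notin> {1..<n} \<longrightarrow> l i = 0)"

text \<open>The letter before reduction modulo n. If the left end stays, the interval of length
  \<open>j - 1\<close> grows to the right by \<open>l j + j - 1\<close>; otherwise the new letter is
  the new left end. At \<open>j = n\<close> both neighbours of the interval coincide modulo n, and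
  the left one is used.\<close>

definition next_letter :: "nat \<Rightarrow> (nat \<Rightarrow> int) \<Rightarrow> nat \<Rightarrow> int" where
  "next_letter n l j =
     (if j = 1 then l 1 else if j = n then l (n - 1) - 1
      else if l j = l (j - 1) then l j + int j - 1 else l j)"

definition path_perm :: "nat \<Rightarrow> (nat \<Rightarrow> int) \<Rightarrow> nat \<Rightarrow> nat" where
  "path_perm n l j = (if j \<in> {1..n} then residue n (next_letter n l j) else j)"

definition path_adj :: "nat \<Rightarrow> (nat \<Rightarrow> int) \<Rightarrow> (nat \<Rightarrow> int) \<Rightarrow> bool" where
  "path_adj n l l' \<longleftrightarrow> lattice_path n l \<and> lattice_path n l' \<and>
     (\<exists>i\<in>{1..<n}. l' = l(i := l i + 1) \<or> l' = l(i := l i - 1))"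

text \<open>These are the deck transformations of the covering.\<close>

definition path_shift :: "nat \<Rightarrow> int \<Rightarrow> (nat \<Rightarrow> int) \<Rightarrow> nat \<Rightarrow> int" where
  "path_shift n k l i = (if i \<in> {1..<n} then l i + int n * k else 0)"

lemma lattice_path_shift: "lattice_path n l \<Longrightarrow> lattice_path n (path_shift n k l)"
  by (auto simp: lattice_path_def path_shift_def)

lemma path_adj_sym: "path_adj n l l' \<Longrightarrow> path_adj n l' l"
  unfolding path_adj_def by (elim conjE bexE disjE) (auto intro!: bexI)

locale arc_cover =
  fixes n :: nat
  assumes n: "n > 2"
begin

lemma path_perm_prefix:
  assumes l: "lattice_path n l" and j: "j \<in> {1..<n}"
  shows "path_perm n l ` {1..j} = cyc n (l j) j"
proof -
  have "1 \<le> j" using j by simp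
  then show ?thesis using j
  proof (induction j rule: dec_induct)
    case base
    have "{l 1..<l 1 + 1} = {l 1}" by auto
    then show ?case using n by (simp add: path_perm_def next_letter_def cyc_def)
  next
    case (step j)
    then have j: "1 \<le> j" "Suc j < n" by auto
    have IH: "path_perm n l ` {1..j} = cyc n (l j) j" using step by auto
    have "{1..Suc j} = insert (Suc j) {1..j}" by auto
    then have e: "path_perm n l ` {1..Suc j} =
        insert (path_perm n l (Suc j)) (cyc n (l j) j)"
      using IH by (simp only: image_insert)
    consider "l j = l (Suc j)" | "l j = l (Suc j) + 1"
      using l j unfolding lattice_path_def by blast
    then show ?case
    proof cases
      case 1
      then have "path_perm n l (Suc j) = residue n (l j + int j)"
        using j by (simp add: path_perm_def next_letter_def)
      then show ?thesis
        using e cyc_Suc_right[of n "l j" j] 1 n by simp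
    next
      case 2
      then have "path_perm n l (Suc j) = residue n (l j - 1)"
        using j by (simp add: path_perm_def next_letter_def)
      then show ?thesis
        using e cyc_Suc_left[of n "l j" j] 2 n by simp
    qed
  qed
qed

lemma path_perm_permutes:
  assumes l: "lattice_path n l"
  shows "path_perm n l permutes {1..n}"
proof -
  have "{1..n} = insert n {1..n - 1}" using n by auto
  then have "path_perm n l ` {1..n} = insert (path_perm n l n) (cyc n (l (n - 1)) (n - 1))"
    using path_perm_prefix[OF l, of "n - 1"] n by simp
  also have "path_perm n l n = residue n (l (n - 1) - 1)"
    using n by (simp add: path_perm_def next_letter_def)
  also have "insert \<dots> (cyc n (l (n - 1)) (n - 1)) = cyc n (l (n - 1) - 1) n"
    using cyc_Suc_left[of n "l (n - 1)" "n - 1"] n by simp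
  also have "\<dots> = {1..n}" using n by (simp add: cyc_full del: One_nat_def)
  finally have im: "path_perm n l ` {1..n} = {1..n}" .
  then have "inj_on (path_perm n l) {1..n}"
    by (intro eq_card_imp_inj_on) simp_all
  then show ?thesis
    using im by (intro bij_imp_permutes) (auto simp: bij_betw_def path_perm_def)
qed

lemma path_perm_arc: "lattice_path n l \<Longrightarrow> path_perm n l \<in> arc_permutations n"
proof -
  assume l: "lattice_path n l"
  have "cyclic_interval n (path_perm n l ` {1..j})" if j: "1 \<le> j" "j \<le> n" for j
  proof (cases "j = n")
    case True
    have "cyclic_interval n {1..n}"
      unfolding cyclic_interval_def using n by (intro exI[of _ 1] exI[of _ n]) simp
    then show ?thesis
      using True permutes_image[OF path_perm_permutes[OF l]] by simp
  next
    case False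
    then have "j < n" "j \<in> {1..<n}" using j by auto
    then show ?thesis
      using path_perm_prefix[OF l] cyclic_interval_iff_cyc[of n j "path_perm n l ` {1..j}"] n j
      by auto
  qed
  then show ?thesis
    using path_perm_permutes[OF l] by (simp add: arc_permutations_def)
qed

lemma ex_path_perm:
  assumes u: "u \<in> arc_permutations n"
  obtains l where "lattice_path n l" "path_perm n l = u"
proof -
  have up: "u permutes {1..n}" using u by (simp add: arc_permutations_def)
  have pre: "\<exists>a. u ` {1..j} = cyc n a j" if "j \<in> {1..<n}" for j
  proof -
    have "card (u ` {1..j}) = j"
      using permutes_inj[OF up] by (simp add: card_image inj_on_subset)
    then show ?thesis
      using cyclic_interval_iff_cyc[of n j "u ` {1..j}"] u n that
      by (auto simp: arc_permutations_def)
  qed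
  have ext: "\<exists>l. (\<forall>i. 1 \<le> i \<and> Suc i \<le> m \<longrightarrow> l i = l (Suc i) \<or> l i = l (Suc i) + 1) \<and>
      (\<forall>j\<in>{1..m}. u ` {1..j} = cyc n (l j) j)" if "1 \<le> m" "m < n" for m
    using that
  proof (induction m rule: dec_induct)
    case base
    obtain a where "u ` {1..1} = cyc n a 1" using pre[of 1] n by auto
    then show ?case by (intro exI[of _ "\<lambda>_. a"]) auto
  next
    case (step m)
    then obtain l where l: "\<And>i. 1 \<le> i \<and> Suc i \<le> m \<Longrightarrow> l i = l (Suc i) \<or> l i = l (Suc i) + 1"
      "\<And>j. j \<in> {1..m} \<Longrightarrow> u ` {1..j} = cyc n (l j) j" by (metis Suc_lessD)
    obtain b where b: "u ` {1..Suc m} = cyc n b (Suc m)" using pre[of "Suc m"] step by auto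
    have "u ` {1..m} \<subseteq> u ` {1..Suc m}" by (intro image_mono) auto
    then have "cyc n (l m) m \<subseteq> cyc n b (Suc m)"
      using l(2)[of m] b step by simp
    then have "int n dvd l m - b \<or> int n dvd l m - 1 - b"
      using cyc_inclusion_step[of n m "l m" b] n step by auto
    \<comment> \<open>The prefix determines its left end only modulo n; \<open>c\<close> is the
      representative that continues the path already built.\<close>
    then obtain c where c: "c = l m \<or> c = l m - 1" "int n dvd c - b" by blast
    then have u': "u ` {1..Suc m} = cyc n c (Suc m)"
      using cyc_cong[of n c b] b n by simp
    show ?case
    proof (intro exI[of _ "l(Suc m := c)"] conjI allI impI ballI)
      fix i assume "1 \<le> i \<and> Suc i \<le> Suc m"
      then show "(l(Suc m := c)) i = (l(Suc m := c)) (Suc i) \<or>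
          (l(Suc m := c)) i = (l(Suc m := c)) (Suc i) + 1"
        using l(1)[of i] c(1) by (cases "i = m") auto
    next
      fix j assume "j \<in> {1..Suc m}"
      then show "u ` {1..j} = cyc n ((l(Suc m := c)) j) j"
        using l(2)[of j] u' by (cases "j = Suc m") auto
    qed
  qed
  have "1 \<le> n - 1" "n - 1 < n" using n by auto
  from ext[OF this] obtain l where l0:
    "(\<forall>i. 1 \<le> i \<and> Suc i \<le> n - 1 \<longrightarrow> l i = l (Suc i) \<or> l i = l (Suc i) + 1) \<and>
      (\<forall>j\<in>{1..n - 1}. u ` {1..j} = cyc n (l j) j)" ..
  note l = l0[THEN conjunct1, rule_format] l0[THEN conjunct2, rule_format]
  define l' where "l' = (\<lambda>i. if i \<in> {1..<n} then l i else 0)"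
  have l': "lattice_path n l'"
    unfolding lattice_path_def
  proof (intro conjI allI impI)
    fix i assume "1 \<le> i \<and> Suc i < n"
    then show "l' i = l' (Suc i) \<or> l' i = l' (Suc i) + 1"
      using l(1)[of i] by (auto simp: l'_def)
  qed (auto simp: l'_def)
  have "path_perm n l' = u"
  proof (rule permutes_eq_if_prefix_images_eq[OF path_perm_permutes[OF l'] up])
    fix j assume j: "j \<in> {1..<n}"
    then have "j \<in> {1..n - 1}" "l' j = l j" by (auto simp: l'_def)
    then show "path_perm n l' ` {1..j} = u ` {1..j}"
      using path_perm_prefix[OF l' j] l(2) by simp
  qed
  then show ?thesis using l' that by blast
qed

lemma path_perm_shift:
  assumes l: "lattice_path n l"
  shows "path_perm n (path_shift n k l) = path_perm n l"
proof (rule permutes_eq_if_prefix_images_eq)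
  show "path_perm n (path_shift n k l) permutes {1..n}" "path_perm n l permutes {1..n}"
    by (intro path_perm_permutes lattice_path_shift l)+
  fix j assume j: "j \<in> {1..<n}"
  have "cyc n (path_shift n k l j) j = cyc n (l j) j"
    using n j by (intro cyc_cong) (auto simp: path_shift_def)
  then show "path_perm n (path_shift n k l) ` {1..j} = path_perm n l ` {1..j}"
    by (simp only: path_perm_prefix[OF l j] path_perm_prefix[OF lattice_path_shift[OF l] j])
qed

text \<open>
  The rounding (d + 1) div n does not change along a sequence of integers whose consecutive
  differences are at most one in absolute value, as long as the entries are multiples of n up to an
  exceptional place i.
\<close>

lemma near_multiple_constant:
  fixes d :: "nat \<Rightarrow> int"
  assumes step: "\<And>j. 1 \<le> j \<Longrightarrow> Suc j < n \<Longrightarrow> \<bar>d j - d (Suc j)\<bar> \<le> 1"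
    and mult: "\<And>j. j \<in> {1..<n} \<Longrightarrow> j \<noteq> i \<Longrightarrow> int n dvd d j"
  obtains k where "\<And>j. j \<in> {1..<n} \<Longrightarrow> j \<noteq> i \<Longrightarrow> d j = int n * k"
    "i \<in> {1..<n} \<Longrightarrow> \<bar>d i - int n * k\<bar> \<le> 1"
proof -
  \<comment> \<open>This is where \<open>n > 2\<close> is needed: \<open>x - n * m + 1\<close> lies
    between 0 and 2, so division by n sends it to 0.\<close>
  have round: "(x + 1) div int n = m" if "\<bar>x - int n * m\<bar> \<le> 1" for x m
  proof -
    have "x + 1 = int n * m + (x - int n * m + 1)" by simp
    moreover have "(x - int n * m + 1) div int n = 0"
      using that n by (intro div_pos_pos_trivial) auto
    ultimately show ?thesis
      using n by (metis add.right_neutral div_mult_self2 mult.commute of_nat_0_less_iff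
          add.commute less_numeral_extra(3) of_nat_0 of_nat_less_iff zero_less_numeral less_trans)
  qed
  define g where "g j = (d j + 1) div int n" for j
  have eq: "g j = g (Suc j)" if j: "1 \<le> j" "Suc j < n" for j
  proof -
    have "int n dvd d j \<or> int n dvd d (Suc j)"
      using mult[of j] mult[of "Suc j"] j by (cases "j = i") simp_all
    then show ?thesis
    proof
      assume "int n dvd d j"
      then obtain m where "d j = int n * m" by blast
      then have "g j = m" "g (Suc j) = m"
        unfolding g_def using step[OF j] by (auto intro!: round)
      then show ?thesis by simp
    next
      assume "int n dvd d (Suc j)"
      then obtain m where "d (Suc j) = int n * m" by blast
      then have "g j = m" "g (Suc j) = m"
        unfolding g_def using step[OF j] by (auto intro!: round)
      then show ?thesis by simp
    qed
  qed
  have const: "g j = g 1" if "1 \<le> j" "j < n" for j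
    using that by (induction j rule: dec_induct) (use eq in auto)
  have off: "d j = int n * g 1" if j: "j \<in> {1..<n}" "j \<noteq> i" for j
  proof -
    obtain m where m: "d j = int n * m" using mult[OF j] by blast
    then have "g j = m" unfolding g_def by (auto intro!: round)
    moreover have "g j = g 1" using const[of j] j by auto
    ultimately show ?thesis using m by simp
  qed
  have "\<bar>d i - int n * g 1\<bar> \<le> 1" if i: "i \<in> {1..<n}"
  proof (cases "i = 1")
    case True
    then show ?thesis using off[of 2] step[of 1] n by (simp add: numeral_2_eq_2)
  next
    case False
    then have "1 \<le> i - 1" "Suc (i - 1) < n" "Suc (i - 1) = i" using i by auto
    then have "\<bar>d (i - 1) - d i\<bar> \<le> 1" using step[of "i - 1"] by simp
    moreover have "d (i - 1) = int n * g 1" using False i by (intro off) auto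
    ultimately show ?thesis by simp
  qed
  then show ?thesis using that off by blast
qed

lemma lattice_path_diff_step:
  assumes "lattice_path n l" "lattice_path n l'" "1 \<le> j" "Suc j < n"
  shows "\<bar>(l j - l' j) - (l (Suc j) - l' (Suc j))\<bar> \<le> 1"
proof -
  have "l j = l (Suc j) \<or> l j = l (Suc j) + 1" "l' j = l' (Suc j) \<or> l' j = l' (Suc j) + 1"
    using assms unfolding lattice_path_def by blast+
  then show ?thesis by auto
qed

lemma path_perm_eq_imp_shift:
  assumes l: "lattice_path n l" and l': "lattice_path n l'" and eq: "path_perm n l = path_perm n l'"
  obtains k where "l = path_shift n k l'"
proof -
  have "int n dvd l j - l' j" if j: "j \<in> {1..<n}" for j
  proof (rule cyc_eq_imp_dvd[of n j])
    show "cyc n (l j) j = cyc n (l' j) j"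
      using path_perm_prefix[OF l j] path_perm_prefix[OF l' j] eq by simp
  qed (use n j in auto)
  \<comment> \<open>The exceptional place is set to 0, outside the range, so there is no
    exception.\<close>
  then obtain k where k: "\<And>j. j \<in> {1..<n} \<Longrightarrow> j \<noteq> 0 \<Longrightarrow> l j - l' j = int n * k"
    using near_multiple_constant[of "\<lambda>j. l j - l' j" 0] lattice_path_diff_step[OF l l'] by metis
  have "l j = path_shift n k l' j" for j
    using k[of j] l by (cases "j \<in> {1..<n}") (auto simp: path_shift_def lattice_path_def)
  then show ?thesis using that by blast
qed

lemma path_adj_imp_arc:
  assumes "path_adj n l l'"
  shows "(path_perm n l, path_perm n l') \<in> arcs (arc_graph n)"
proof -
  from assms obtain i where l: "lattice_path n l" and l': "lattice_path n l'" and i: "i \<in> {1..<n}"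
    and upd: "l' = l(i := l i + 1) \<or> l' = l(i := l i - 1)"
    by (auto simp: path_adj_def)
  have "path_perm n l ` {1..j} = path_perm n l' ` {1..j}" if "j \<in> {1..<n}" "j \<noteq> i" for j
    using that upd path_perm_prefix[OF l] path_perm_prefix[OF l'] by auto
  moreover have "path_perm n l \<noteq> path_perm n l'"
  proof
    assume "path_perm n l = path_perm n l'"
    then obtain k where k: "l = path_shift n k l'" using path_perm_eq_imp_shift[OF l l'] by blast
    then have "l i = l' i + int n * k" using i by (simp add: path_shift_def)
    moreover have "l' i = l i + 1 \<or> l' i = l i - 1" using upd by (metis fun_upd_same)
    ultimately have "\<bar>int n * k\<bar> = 1" by linarith
    then have "int n dvd 1" by (metis dvd_abs_iff dvd_triv_left)
    then show False using n by simp
  qed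
  ultimately have "path_perm n l = path_perm n l' \<circ> transpose i (i + 1)"
    using path_perm_permutes[OF l] path_perm_permutes[OF l'] i
    by (intro permutes_transpose_if_prefix_images_eq) auto
  then show ?thesis
    using path_perm_arc[OF l] path_perm_arc[OF l'] i unfolding arc_graph_def
    by (simp only: pre_digraph.simps mem_Collect_eq prod.case) fastforce
qed

text \<open>Any lift of \<open>v\<close> differs from \<open>l\<close> by one fixed multiple of n
  away from position \<open>i\<close>. Shifting it back leaves a difference at \<open>i\<close>
  alone, of size at most one because a neighbouring entry agrees with \<open>l\<close>, and not zero
  because the transposition moves something.\<close>

lemma arc_lift:
  assumes l: "lattice_path n l" and a: "(path_perm n l, v) \<in> arcs (arc_graph n)"
  obtains l' where "path_adj n l l'" "path_perm n l' = v"
proof -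
  from a obtain i where v: "v \<in> arc_permutations n" and "1 \<le> i" "i \<le> n - 1"
    and eq: "path_perm n l = v \<circ> transpose i (i + 1)"
    unfolding arc_graph_def by auto
  then have i: "i \<in> {1..<n}" using n by auto
  obtain l'' where l'': "lattice_path n l''" "path_perm n l'' = v"
    using ex_path_perm[OF v] by blast
  have "int n dvd l'' j - l j" if j: "j \<in> {1..<n}" "j \<noteq> i" for j
  proof (rule cyc_eq_imp_dvd[of n j])
    have "transpose i (i + 1) ` {1..j} = {1..j}"
      using j i by (cases "j < i") (auto simp: transpose_def image_iff)
    then have "path_perm n l ` {1..j} = v ` {1..j}"
      unfolding eq by (simp only: image_comp[symmetric])
    then show "cyc n (l'' j) j = cyc n (l j) j"
      using path_perm_prefix[OF l j(1)] path_perm_prefix[OF l''(1) j(1)] l''(2) by simp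
  qed (use n j in auto)
  then obtain k where k: "\<And>j. j \<in> {1..<n} \<Longrightarrow> j \<noteq> i \<Longrightarrow> l'' j - l j = int n * k"
      "\<bar>l'' i - l i - int n * k\<bar> \<le> 1"
    using near_multiple_constant[of "\<lambda>j. l'' j - l j" i] lattice_path_diff_step[OF l''(1) l] i by metis
  define l' where "l' = path_shift n (- k) l''"
  have l': "lattice_path n l'" "path_perm n l' = v"
    using l'' by (simp_all add: l'_def lattice_path_shift path_perm_shift)
  have off: "l' j = l j" if "j \<noteq> i" for j
    using k(1)[of j] that l unfolding l'_def path_shift_def lattice_path_def by auto
  have "\<bar>l' i - l i\<bar> \<le> 1" using k(2) i by (simp add: l'_def path_shift_def)
  moreover have "l' i \<noteq> l i"
  proof
    assume "l' i = l i"
    then have "l' = l" using off by (intro ext) metis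
    then have "v = v \<circ> transpose i (i + 1)" using l'(2) eq by simp
    then have "v i = v (i + 1)" by (metis comp_apply transpose_apply_first)
    then show False
      using v permutes_inj[of v "{1..n}"] by (auto simp: arc_permutations_def dest: injD)
  qed
  ultimately have "l' i = l i + 1 \<or> l' i = l i - 1" by auto
  then have "l' = l(i := l i + 1) \<or> l' = l(i := l i - 1)"
    using off by (auto simp: fun_eq_iff)
  then have "path_adj n l l'" using l l' i by (auto simp: path_adj_def)
  then show ?thesis using l' that by blast
qed

text \<open>Two neighbours of one path differ by at most 2 in each entry, too little for a
  nontrivial shift when \<open>n > 2\<close>.\<close>

lemma path_adj_unique:
  assumes "path_adj n l l1" "path_adj n l l2" "path_perm n l1 = path_perm n l2"
  shows "l1 = l2"
proof -
  obtain k where k: "l1 = path_shift n k l2"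
    using path_perm_eq_imp_shift[of l1 l2] assms by (auto simp: path_adj_def)
  have "\<bar>l1 1 - l 1\<bar> \<le> 1" "\<bar>l2 1 - l 1\<bar> \<le> 1"
    using assms by (auto simp: path_adj_def)
  moreover have "l1 1 = l2 1 + int n * k" using k n by (simp add: path_shift_def)
  ultimately have "- int n < int n * k" "int n * k < int n"
    using n by linarith+
  then have "int n * k = 0"
    using n by (intro small_multiple[of n]) auto
  then have "k = 0" using n by simp
  then show ?thesis
    using k assms(2) by (auto simp: path_shift_def path_adj_def lattice_path_def fun_eq_iff)
qed

end

section \<open>Walks and distances\<close>

context wf_digraph
begin

lemma awalk_cost_unit: "awalk_cost (\<lambda>_. 1) p = real (length p)"
  by (induction p) simp_all

lemma graph_dist_le: "awalk u p v \<Longrightarrow> graph_dist G u v \<le> ereal (real (length p))"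
  unfolding graph_dist_def using min_cost_le_walk_cost[of u p v "\<lambda>_. 1"]
  by (simp add: awalk_cost_unit)

lemma graph_dist_eqI:
  assumes "awalk u p v" "length p = d" "\<And>q. awalk u q v \<Longrightarrow> d \<le> length q"
  shows "graph_dist G u v = ereal (real d)"
proof (rule antisym)
  show "graph_dist G u v \<le> ereal (real d)"
    using graph_dist_le assms by blast
  show "ereal (real d) \<le> graph_dist G u v"
    unfolding graph_dist_def \<mu>_def
    using assms(3) by (intro INF_greatest) (auto simp: awalk_cost_unit)
qed

text \<open>A walk of minimal length repeats no vertex, since a closed piece could be cut out; so
  simplicity of geodesics need not be tracked when walks are lifted.\<close>

lemma geodesic_iff_awalk:
  "geodesic G u p v \<longleftrightarrow> awalk u p v \<and> ereal (real (length p)) = graph_dist G u v"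
proof
  assume g: "awalk u p v \<and> ereal (real (length p)) = graph_dist G u v"
  have "distinct (awalk_verts u p)"
  proof (rule ccontr)
    assume "\<not> distinct (awalk_verts u p)"
    then obtain q r s w where "p = q @ r @ s" "0 < length r" "awalk u q w" "awalk w s v"
      using awalk_not_distinct_decomp[of u p v] g by (metis length_greater_0_conv)
    then have "awalk u (q @ s) v" "length (q @ s) < length p"
      by (auto simp: awalk_appendI)
    then show False
      using graph_dist_le[of u "q @ s" v] g by (metis ereal_less_eq(3) linorder_not_le of_nat_less_iff)
  qed
  then show "geodesic G u p v"
    using g by (simp add: geodesic_def apath_def)
qed (auto simp: geodesic_def apath_def)

end

section \<open>Walks between lattice paths and the sum distance\<close>

fun path_walk :: "nat \<Rightarrow> (nat \<Rightarrow> int) \<Rightarrow> ((nat \<Rightarrow> int) \<times> (nat \<Rightarrow> int)) list \<Rightarrow> (nat \<Rightarrow> int) \<Rightarrow> bool" where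
  "path_walk n l [] l' \<longleftrightarrow> lattice_path n l \<and> l' = l"
| "path_walk n l (e # p) l' \<longleftrightarrow> fst e = l \<and> path_adj n l (snd e) \<and> path_walk n (snd e) p l'"

definition path_dist :: "nat \<Rightarrow> (nat \<Rightarrow> int) \<Rightarrow> (nat \<Rightarrow> int) \<Rightarrow> nat" where
  "path_dist n l l' = (\<Sum>i\<in>{1..<n}. nat \<bar>l i - l' i\<bar>)"

text \<open>Steps of lattice paths are pairs, just like the arcs of the graph, so the covering map
  acts on walks componentwise.\<close>

definition walk_perms where
  "walk_perms n = map (map_prod (path_perm n) (path_perm n))"

lemma path_walk_ends: "path_walk n l p l' \<Longrightarrow> lattice_path n l \<and> lattice_path n l'"
  by (induction p arbitrary: l) (auto simp: path_adj_def)

lemma path_walk_end_unique: "path_walk n l p l1 \<Longrightarrow> path_walk n l p l2 \<Longrightarrow> l1 = l2"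
  by (induction p arbitrary: l) auto

lemma path_walk_snoc: "path_walk n l p m \<Longrightarrow> path_adj n m l' \<Longrightarrow> path_walk n l (p @ [(m, l')]) l'"
  by (induction p arbitrary: l) (auto simp: path_adj_def)

lemma length_walk_perms [simp]: "length (walk_perms n p) = length p"
  by (simp add: walk_perms_def)

lemma path_dist_commute: "path_dist n l l' = path_dist n l' l"
  by (simp add: path_dist_def abs_minus_commute)

lemma path_dist_triangle: "path_dist n l l' \<le> path_dist n l m + path_dist n m l'"
  unfolding path_dist_def sum.distrib[symmetric] by (intro sum_mono) auto

lemma path_dist_self [simp]: "path_dist n l l = 0"
  by (simp add: path_dist_def)

lemma path_dist_eq_0:
  assumes "lattice_path n l" "lattice_path n l'" "path_dist n l l' = 0"
  shows "l = l'"
proof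
  fix i
  show "l i = l' i"
    using assms by (cases "i \<in> {1..<n}") (auto simp: path_dist_def lattice_path_def)
qed

lemma path_dist_upd:
  assumes "i \<in> {1..<n}"
  shows "path_dist n (l(i := x)) l' + nat \<bar>l i - l' i\<bar> = path_dist n l l' + nat \<bar>x - l' i\<bar>"
proof -
  have "path_dist n m l' = nat \<bar>m i - l' i\<bar> + (\<Sum>j\<in>{1..<n} - {i}. nat \<bar>m j - l' j\<bar>)" for m
    unfolding path_dist_def using assms by (intro sum.remove) auto
  from this[of l] this[of "l(i := x)"] show ?thesis by simp
qed

lemma path_adj_dist:
  assumes "path_adj n l m"
  shows "path_dist n l m = 1"
proof -
  obtain i x where i: "i \<in> {1..<n}" "m = l(i := x)" "\<bar>x - l i\<bar> = 1"
    using assms by (auto simp: path_adj_def)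
  then show ?thesis
    using path_dist_upd[OF i(1), of l x l] by (simp add: path_dist_commute)
qed

lemma path_dist_le_length: "path_walk n l p l' \<Longrightarrow> path_dist n l l' \<le> length p"
proof (induction p arbitrary: l)
  case (Cons e p)
  then show ?case
    using path_dist_triangle[of n l l' "snd e"] path_adj_dist[of n l "snd e"] by fastforce
qed simp

lemma path_dist_descent:
  assumes l: "lattice_path n l" and l': "lattice_path n l'" and "\<exists>i\<in>{1..<n}. l i < l' i"
  obtains m where "path_adj n l m" "path_dist n l l' = Suc (path_dist n m l')"
proof -
  define P where "P i \<longleftrightarrow> i \<in> {1..<n} \<and> l i < l' i" for i
  \<comment> \<open>Raising an entry must not create an ascent from \<open>i - 1\<close> or a drop
    of two to \<open>i + 1\<close>. If \<open>l (i - 1) = l i\<close>, then \<open>i - 1\<close> is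
    also below its target; if \<open>l i = l (Suc i) + 1\<close>, then \<open>Suc i\<close> is. With
    weight 2 on the value, \<open>f\<close> falls by one in either case, so a minimiser of
    \<open>f\<close> can be raised.\<close>
  define f where "f i = 2 * l i + int i" for i
  have "finite (Collect P)"
    by (rule finite_subset[of _ "{1..<n}"]) (auto simp: P_def)
  moreover have "Collect P \<noteq> {}" using assms(3) unfolding P_def by auto
  ultimately obtain i where "i \<in> Collect P" "\<And>j. j \<in> Collect P \<Longrightarrow> f i \<le> f j"
    using obtains_MIN[of "Collect P" f] by (metis Min_le finite_imageI image_eqI)
  then have i: "i \<in> {1..<n}" "l i < l' i"
    and min: "\<And>j. j \<in> {1..<n} \<Longrightarrow> l j < l' j \<Longrightarrow> 2 * l i + int i \<le> 2 * l j + int j"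
    by (auto simp: P_def f_def)
  define m where "m = l(i := l i + 1)"
  have left: "l (i - 1) = l i + 1" if "i \<noteq> 1"
  proof (rule ccontr)
    assume "l (i - 1) \<noteq> l i + 1"
    have j: "i - 1 \<in> {1..<n}" "1 \<le> i - 1" "Suc (i - 1) = i" "i < n" using i that by auto
    then have "l (i - 1) = l i"
      using l \<open>l (i - 1) \<noteq> l i + 1\<close> unfolding lattice_path_def by metis
    moreover have "l' i \<le> l' (i - 1)"
    proof -
      have "l' (i - 1) = l' i \<or> l' (i - 1) = l' i + 1"
        using l' j unfolding lattice_path_def by metis
      then show ?thesis by auto
    qed
    ultimately show False using min[OF j(1)] i j by linarith
  qed
  have right: "l i = l (Suc i)" if "Suc i < n"
  proof (rule ccontr)
    assume "l i \<noteq> l (Suc i)"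
    then have "l i = l (Suc i) + 1"
      using l i that unfolding lattice_path_def by auto
    moreover have "l' i \<le> l' (Suc i) + 1"
      using l' i that unfolding lattice_path_def by force
    ultimately show False using min[of "Suc i"] i that by auto
  qed
  have "lattice_path n m"
    unfolding lattice_path_def
  proof (intro conjI allI impI)
    fix j assume j: "1 \<le> j \<and> Suc j < n"
    then have "l j = l (Suc j) \<or> l j = l (Suc j) + 1"
      using l unfolding lattice_path_def by blast
    then show "m j = m (Suc j) \<or> m j = m (Suc j) + 1"
      using left right j unfolding m_def by (cases "j = i"; cases "Suc j = i") auto
  next
    fix j assume "j \<notin> {1..<n}"
    then show "m j = 0" using l i by (auto simp: m_def lattice_path_def)
  qed
  then have "path_adj n l m" using l i(1) by (auto simp: path_adj_def m_def)
  moreover have "path_dist n l l' = Suc (path_dist n m l')"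
    using path_dist_upd[OF i(1), of l "l i + 1" l'] i(2) by (simp add: m_def)
  ultimately show ?thesis using that by blast
qed

text \<open>\<open>path_dist_descent\<close> only raises entries. If some entry of \<open>l\<close>
  lies above its target instead, the target is raised and that step, reversed, ends the
  walk.\<close>

lemma ex_path_walk:
  assumes "lattice_path n l" "lattice_path n l'"
  obtains p where "path_walk n l p l'" "length p = path_dist n l l'"
proof -
  have "\<exists>p. path_walk n l p l' \<and> length p = path_dist n l l'"
    using assms
  proof (induction "path_dist n l l'" arbitrary: l l')
    case 0
    then have "l = l'" by (intro path_dist_eq_0) auto
    then show ?case using 0 by (intro exI[of _ "[]"]) simp
  next
    case (Suc d)
    have "\<exists>i\<in>{1..<n}. l i \<noteq> l' i"
    proof (rule ccontr)
      assume "\<not> ?thesis"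
      then have "path_dist n l l' = 0" by (simp add: path_dist_def)
      then show False using Suc by simp
    qed
    then consider "\<exists>i\<in>{1..<n}. l i < l' i" | "\<exists>i\<in>{1..<n}. l' i < l i" by (meson linorder_neqE)
    then show ?case
    proof cases
      case 1
      obtain m where m: "path_adj n l m" "path_dist n l l' = Suc (path_dist n m l')"
        using path_dist_descent[OF Suc.prems 1] by blast
      then obtain p where "path_walk n m p l'" "length p = path_dist n m l'"
        using Suc by (metis nat.inject path_adj_def)
      then show ?thesis using m by (intro exI[of _ "(l, m) # p"]) simp
    next
      case 2
      obtain m where m: "path_adj n l' m" "path_dist n l' l = Suc (path_dist n m l)"
        using path_dist_descent[OF Suc.prems(2,1) 2] by blast
      then obtain p where "path_walk n l p m" "length p = path_dist n l m"
        using Suc by (metis nat.inject path_adj_def path_dist_commute)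
      then show ?thesis
        using m path_walk_snoc[OF _ path_adj_sym]
        by (intro exI[of _ "p @ [(m, l')]"]) (simp add: path_dist_commute)
    qed
  qed
  then show ?thesis using that by blast
qed

section \<open>Lifting of walks and comparison of distances\<close>

lemma arc_graph_sel [simp]:
  "verts (arc_graph n) = arc_permutations n" "tail (arc_graph n) = fst" "head (arc_graph n) = snd"
  by (simp_all add: arc_graph_def)

sublocale arc_cover \<subseteq> graph "arc_graph n"
  by (rule graph_arc_graph)

context arc_cover
begin

lemma awalk_walk_perms:
  "path_walk n l p l' \<Longrightarrow> awalk (path_perm n l) (walk_perms n p) (path_perm n l')"
proof (induction p arbitrary: l)
  case Nil
  then show ?case
    using path_perm_arc by (auto simp: awalk_Nil_iff walk_perms_def)
next
  case (Cons e p)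
  then have "awalk (path_perm n (snd e)) (walk_perms n p) (path_perm n l')" by simp
  moreover have "(path_perm n (fst e), path_perm n (snd e)) \<in> arcs (arc_graph n)"
    using Cons.prems path_adj_imp_arc by auto
  ultimately show ?case
    using Cons.prems
    by (cases e) (auto simp: awalk_Cons_iff walk_perms_def)
qed

lemma awalk_lift:
  assumes "lattice_path n l" "awalk (path_perm n l) q v"
  obtains p l' where "path_walk n l p l'" "walk_perms n p = q" "path_perm n l' = v"
proof -
  have "\<exists>p l'. path_walk n l p l' \<and> walk_perms n p = q \<and> path_perm n l' = v"
    using assms
  proof (induction q arbitrary: l)
    case Nil
    then show ?case
      by (intro exI[of _ "[]"] exI[of _ l]) (simp add: walk_perms_def awalk_Nil_iff)
  next
    case (Cons a q)
    obtain w where a: "a = (path_perm n l, w)" "a \<in> arcs (arc_graph n)" "awalk w q v"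
      using Cons.prems(2) by (cases a) (auto simp: awalk_Cons_iff)
    then obtain m where m: "path_adj n l m" "path_perm n m = w"
      using arc_lift[OF Cons.prems(1)] by blast
    then obtain p l' where "path_walk n m p l'" "walk_perms n p = q" "path_perm n l' = v"
      using Cons.IH[of m] a by (auto simp: path_adj_def)
    then show ?case
      using m a by (intro exI[of _ "(l, m) # p"] exI[of _ l']) (simp add: walk_perms_def)
  qed
  then show ?thesis using that by blast
qed

text \<open>Unique lifting of walks from a common start. The ends \<open>l1\<close> and
  \<open>l2\<close> may differ, which later allows both families of geodesics to be treated at
  once.\<close>

lemma walk_perms_inj:
  "path_walk n l p1 l1 \<Longrightarrow> path_walk n l p2 l2 \<Longrightarrow> walk_perms n p1 = walk_perms n p2 \<Longrightarrow> p1 = p2"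
proof (induction p1 arbitrary: l p2)
  case (Cons e p1)
  then obtain e' p2' where p2: "p2 = e' # p2'"
    by (cases p2) (auto simp: walk_perms_def)
  have "snd e = snd e'"
    using Cons.prems p2 by (intro path_adj_unique[of l]) (auto simp: walk_perms_def prod_eq_iff)
  then show ?case
    using Cons p2 by (auto simp: walk_perms_def prod_eq_iff)
qed (simp add: walk_perms_def)

text \<open>A walk in the graph lifts to one that ends at some shift of \<open>l'\<close>, so the
  graph distance is the least distance to such a shift.\<close>

lemma graph_dist_path_perm:
  assumes l: "lattice_path n l" and l': "lattice_path n l'"
    and min: "\<And>k. path_dist n l l' \<le> path_dist n l (path_shift n k l')"
  shows "graph_dist (arc_graph n) (path_perm n l) (path_perm n l') = ereal (real (path_dist n l l'))"
proof -
  obtain p where p: "path_walk n l p l'" "length p = path_dist n l l'"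
    using ex_path_walk[OF l l'] by blast
  show ?thesis
  proof (rule graph_dist_eqI[OF awalk_walk_perms[OF p(1)]])
    fix q assume "awalk (path_perm n l) q (path_perm n l')"
    then obtain r m where r: "path_walk n l r m" "walk_perms n r = q" "path_perm n m = path_perm n l'"
      using awalk_lift[OF l] by blast
    then obtain k where "m = path_shift n k l'"
      using path_perm_eq_imp_shift[of m l'] l' path_walk_ends by blast
    then show "path_dist n l l' \<le> length q"
      using path_dist_le_length[OF r(1)] min[of k] r(2) by force
  qed (simp add: p)
qed

lemma graph_dist_path_perm_le:
  assumes l: "lattice_path n l" and l': "lattice_path n l'"
  shows "graph_dist (arc_graph n) (path_perm n l) (path_perm n l') \<le> ereal (real (path_dist n l l'))"
proof -
  obtain p where p: "path_walk n l p l'" "length p = path_dist n l l'"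
    using ex_path_walk[OF l l'] by blast
  show ?thesis
    using graph_dist_le[OF awalk_walk_perms[OF p(1)]] p(2) by simp
qed

section \<open>The upper bound for the diameter\<close>

lemma sum_nat_bound:
  assumes "\<And>i. i \<in> {1..<n} \<Longrightarrow> f i + g i \<le> n"
  shows "sum f {1..<n} + sum g {1..<n} \<le> 2 * (n choose 2)"
proof -
  have "sum f {1..<n} + sum g {1..<n} \<le> (\<Sum>i\<in>{1..<n}. n)"
    unfolding sum.distrib[symmetric] using assms by (intro sum_mono) auto
  also have "\<dots> = 2 * (n choose 2)"
    using even_mult_iff[of n "n - 1"] n by (simp add: choose_two mult.commute)
  finally show ?thesis .
qed

text \<open>
  If the difference d of the two paths is divisible by n somewhere, say at j, then shifting makes it
  vanish there, and the distance is at most the sum of the numbers |i - j|, which is estimated by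
  pairing i with n - i.  Otherwise d stays strictly between two consecutive multiples of n, and one of
  the two shifts that correspond to these is short.
\<close>

lemma ex_short_shift:
  assumes l: "lattice_path n l" and l': "lattice_path n l'"
  obtains k where "path_dist n l (path_shift n k l') \<le> n choose 2"
proof -
  define d where "d i = l i - l' i" for i
  have step: "\<bar>d j - d (Suc j)\<bar> \<le> 1" if "1 \<le> j" "Suc j < n" for j
    using lattice_path_diff_step[OF l l' that] by (simp add: d_def)
  have dist: "path_dist n l (path_shift n k l') = (\<Sum>i\<in>{1..<n}. nat \<bar>d i - int n * k\<bar>)" for k
    by (auto simp: path_dist_def path_shift_def d_def algebra_simps intro!: sum.cong)
  show ?thesis
  proof (cases "\<exists>j\<in>{1..<n}. int n dvd d j")
    case True
    then obtain j k where j: "j \<in> {1..<n}" "d j = int n * k" by blast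
    have lip: "\<bar>d a - d (a + t)\<bar> \<le> int t" if "1 \<le> a" "a + t < n" for a t
      using that(2)
    proof (induction t)
      case (Suc t)
      then show ?case using step[of "a + t"] that(1) by auto
    qed simp
    have lip': "nat \<bar>d i - int n * k\<bar> \<le> nat \<bar>int i - int j\<bar>" if i: "i \<in> {1..<n}" for i
    proof (cases "i \<le> j")
      case True
      then show ?thesis using lip[of i "j - i"] i j by auto
    next
      case False
      then show ?thesis using lip[of j "i - j"] i j by auto
    qed
    have "path_dist n l (path_shift n k l') \<le> (\<Sum>i\<in>{1..<n}. nat \<bar>int i - int j\<bar>)"
      unfolding dist using lip' by (rule sum_mono)
    moreover have "(\<Sum>i\<in>{1..<n}. nat \<bar>int i - int j\<bar>) = (\<Sum>i\<in>{1..<n}. nat \<bar>int (n - i) - int j\<bar>)"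
      by (rule sum.reindex_bij_witness[of _ "\<lambda>i. n - i" "\<lambda>i. n - i"]) auto
    \<comment> \<open>At each position the two terms add up to the maximum of |n - 2j| and |2i - n|,
      which is below n.\<close>
    moreover have "(\<Sum>i\<in>{1..<n}. nat \<bar>int i - int j\<bar>) + (\<Sum>i\<in>{1..<n}. nat \<bar>int (n - i) - int j\<bar>)
        \<le> 2 * (n choose 2)"
      using j by (intro sum_nat_bound) auto
    ultimately show ?thesis using that[of k] by linarith
  next
    case False
    then have nd: "\<not> int n dvd d j" if "j \<in> {1..<n}" for j using that by blast
    have bounds: "int n * (d j div int n) < d j \<and> d j < int n * (d j div int n) + int n"
      if "j \<in> {1..<n}" for j
    proof -
      have "d j mod int n \<noteq> 0" using nd[OF that] by (simp add: dvd_eq_mod_eq_0)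
      moreover have "0 \<le> d j mod int n" "d j mod int n < int n" using n by auto
      moreover have "d j = int n * (d j div int n) + d j mod int n" by simp
      ultimately show ?thesis by linarith
    qed
    have eq: "d j div int n = d (Suc j) div int n" if j: "1 \<le> j" "Suc j < n" for j
    proof -
      let ?q = "d j div int n"
      have "d (Suc j) \<noteq> int n * ?q" "d (Suc j) \<noteq> int n * ?q + int n"
        using nd[of "Suc j"] j by (metis atLeastLessThan_iff dvd_triv_left le_SucI,
          metis atLeastLessThan_iff dvd_add dvd_refl dvd_triv_left le_SucI)
      then have "int n * ?q < d (Suc j)" "d (Suc j) < int n * ?q + int n"
        using bounds[of j] step[OF j] j by auto
      then have "d (Suc j) div int n = ?q"
        by (intro int_div_pos_eq[of _ _ _ "d (Suc j) - int n * ?q"]) auto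
      then show ?thesis by simp
    qed
    define k where "k = d 1 div int n"
    have "d j div int n = k" if "1 \<le> j" "j < n" for j
      using that by (induction j rule: dec_induct) (use eq in \<open>auto simp: k_def\<close>)
    then have b: "int n * k < d j \<and> d j < int n * k + int n" if "j \<in> {1..<n}" for j
      using bounds[OF that] that by auto
    \<comment> \<open>At each position the distances to the two enclosing multiples of n add up to
      n, so one of the two shifts is at most average.\<close>
    have "path_dist n l (path_shift n k l') + path_dist n l (path_shift n (k + 1) l') \<le> 2 * (n choose 2)"
      unfolding dist
    proof (rule sum_nat_bound)
      fix j assume "j \<in> {1..<n}"
      from b[OF this] show "nat \<bar>d j - int n * k\<bar> + nat \<bar>d j - int n * (k + 1)\<bar> \<le> n"
        by (simp add: distrib_left nat_add_distrib[symmetric])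
    qed
    then show ?thesis using that[of k] that[of "k + 1"] by linarith
  qed
qed

end

section \<open>Paths between the identity and the reversal\<close>

definition const_path :: "nat \<Rightarrow> nat \<Rightarrow> int" where
  "const_path n i = (if i \<in> {1..<n} then 1 else 0)"

definition top_path :: "nat \<Rightarrow> nat \<Rightarrow> int" where
  "top_path n i = (if i \<in> {1..<n} then int n + 1 - int i else 0)"

text \<open>On permutations this is conjugation by the reversal: pass to the complementary arc and
  send z to 1 - z. It fixes both the identity and the reversal, but swaps the two nearest lifts of
  the latter.\<close>

definition path_reflect :: "nat \<Rightarrow> (nat \<Rightarrow> int) \<Rightarrow> nat \<Rightarrow> int" where
  "path_reflect n l i = (if i \<in> {1..<n} then 2 - l (n - i) else 0)"

definition path_walks where
  "path_walks n l l' m = {p. path_walk n l p l' \<and> length p = m}"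

text \<open>The metric interval: the points that lie on shortest walks from \<open>a\<close> to
  \<open>b\<close>.\<close>

definition path_interval where
  "path_interval n a b = {l. lattice_path n l \<and> path_dist n a l + path_dist n l b = path_dist n a b}"

lemma lattice_path_const: "lattice_path n (const_path n)"
  by (auto simp: lattice_path_def const_path_def)

lemma lattice_path_top: "lattice_path n (top_path n)"
  by (auto simp: lattice_path_def top_path_def)

lemma sum_Ico_choose_two: "(\<Sum>i\<in>{1..<n}. i) = n choose 2"
proof (induction n)
  case (Suc n)
  then show ?case by (cases n) (auto simp: numeral_2_eq_2 atLeastLessThanSuc)
qed simp

lemma sum_Ico_reverse_choose_two: "(\<Sum>i\<in>{1..<n}. n - i) = n choose 2"
  unfolding sum_Ico_choose_two[symmetric]
  by (rule sum.reindex_bij_witness[of _ "\<lambda>i. n - i" "\<lambda>i. n - i"]) auto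

section \<open>The reflection of paths and walks\<close>

lemma path_reflect_path:
  assumes l: "lattice_path n l"
  shows "lattice_path n (path_reflect n l)"
  unfolding lattice_path_def
proof (intro conjI allI impI)
  fix i assume i: "1 \<le> i \<and> Suc i < n"
  then have "1 \<le> n - Suc i \<and> Suc (n - Suc i) < n" "Suc (n - Suc i) = n - i" by auto
  then have "l (n - Suc i) = l (n - i) \<or> l (n - Suc i) = l (n - i) + 1"
    using l unfolding lattice_path_def by metis
  then show "path_reflect n l i = path_reflect n l (Suc i) \<or>
      path_reflect n l i = path_reflect n l (Suc i) + 1"
    using i by (auto simp: path_reflect_def)
qed (auto simp: path_reflect_def)

lemma path_reflect_reflect: "lattice_path n l \<Longrightarrow> path_reflect n (path_reflect n l) = l"
  by (rule ext) (auto simp: path_reflect_def lattice_path_def)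

lemma path_reflect_const: "path_reflect n (const_path n) = const_path n"
  by (rule ext) (auto simp: path_reflect_def const_path_def)

lemma path_reflect_top: "path_reflect n (top_path n) = path_shift n (- 1) (top_path n)"
  by (rule ext) (auto simp: path_reflect_def top_path_def path_shift_def)

lemma path_dist_reflect: "path_dist n (path_reflect n l) (path_reflect n l') = path_dist n l l'"
  unfolding path_dist_def
  by (rule sum.reindex_bij_witness[of _ "\<lambda>i. n - i" "\<lambda>i. n - i"]) (auto simp: path_reflect_def)

lemma path_adj_reflect:
  assumes "path_adj n l m"
  shows "path_adj n (path_reflect n l) (path_reflect n m)"
proof -
  obtain i where l: "lattice_path n l" "lattice_path n m" and i: "i \<in> {1..<n}"
    and m: "m = l(i := l i + 1) \<or> m = l(i := l i - 1)"
    using assms by (auto simp: path_adj_def)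
  have "path_reflect n m = (path_reflect n l)(n - i := path_reflect n l (n - i) - 1) \<or>
      path_reflect n m = (path_reflect n l)(n - i := path_reflect n l (n - i) + 1)"
    using m
  proof
    assume "m = l(i := l i + 1)"
    then have "path_reflect n m = (path_reflect n l)(n - i := path_reflect n l (n - i) - 1)"
      using i by (intro ext) (auto simp: path_reflect_def)
    then show ?thesis ..
  next
    assume "m = l(i := l i - 1)"
    then have "path_reflect n m = (path_reflect n l)(n - i := path_reflect n l (n - i) + 1)"
      using i by (intro ext) (auto simp: path_reflect_def)
    then show ?thesis ..
  qed
  moreover have "n - i \<in> {1..<n}" using i by auto
  ultimately show ?thesis
    using l path_reflect_path unfolding path_adj_def by blast
qed

definition walk_reflect where
  "walk_reflect n = map (map_prod (path_reflect n) (path_reflect n))"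

lemma path_walk_reflect:
  "path_walk n l p l' \<Longrightarrow> path_walk n (path_reflect n l) (walk_reflect n p) (path_reflect n l')"
  by (induction p arbitrary: l) (auto simp: walk_reflect_def path_reflect_path path_adj_reflect)

lemma walk_reflect_reflect:
  "path_walk n l p l' \<Longrightarrow> walk_reflect n (walk_reflect n p) = p"
proof (induction p arbitrary: l)
  case (Cons e p)
  then have "lattice_path n (fst e)" "lattice_path n (snd e)" by (auto simp: path_adj_def)
  then show ?case using Cons by (cases e) (auto simp: walk_reflect_def path_reflect_reflect)
qed (simp add: walk_reflect_def)

lemma card_path_walks_reflect:
  assumes "lattice_path n l" "lattice_path n l'"
  shows "card (path_walks n (path_reflect n l) (path_reflect n l') m) = card (path_walks n l l' m)"
proof (rule sym, rule bij_betw_same_card[of "walk_reflect n"],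
    rule bij_betw_byWitness[where f' = "walk_reflect n"])
  show "\<forall>p\<in>path_walks n l l' m. walk_reflect n (walk_reflect n p) = p"
    "\<forall>p\<in>path_walks n (path_reflect n l) (path_reflect n l') m. walk_reflect n (walk_reflect n p) = p"
    using walk_reflect_reflect by (auto simp: path_walks_def)
  have len: "length (walk_reflect n p) = length p" for p
    by (simp add: walk_reflect_def)
  show "walk_reflect n ` path_walks n l l' m \<subseteq> path_walks n (path_reflect n l) (path_reflect n l') m"
    using path_walk_reflect len by (auto simp: path_walks_def)
  show "walk_reflect n ` path_walks n (path_reflect n l) (path_reflect n l') m \<subseteq> path_walks n l l' m"
    using path_walk_reflect[of n "path_reflect n l" _ "path_reflect n l'"] len
    by (auto simp: path_walks_def path_reflect_reflect assms)
qed

lemma path_interval_reflect: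
  assumes a: "lattice_path n a" and b: "lattice_path n b"
  shows "path_interval n (path_reflect n a) (path_reflect n b) = path_reflect n ` path_interval n a b"
proof -
  have sub: "path_reflect n ` path_interval n a b \<subseteq> path_interval n (path_reflect n a) (path_reflect n b)" for a b
    by (auto simp: path_interval_def path_reflect_path path_dist_reflect)
  have "path_interval n (path_reflect n a) (path_reflect n b) =
      path_reflect n ` path_reflect n ` path_interval n (path_reflect n a) (path_reflect n b)"
    unfolding image_image
    by (rule sym, rule image_cong[THEN trans, OF refl _ image_ident])
      (simp add: path_interval_def path_reflect_reflect)
  also have "\<dots> \<subseteq> path_reflect n ` path_interval n a b"
    using sub[of "path_reflect n a" "path_reflect n b"] a b
    by (intro image_mono) (simp add: path_reflect_reflect)
  finally show ?thesis using sub by blast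
qed

text \<open>
  A set S of step positions encodes the path between the two end paths that is horizontal exactly at
  the elements of S, the value at the virtual position n being 1.
\<close>

definition subset_path :: "nat \<Rightarrow> nat set \<Rightarrow> nat \<Rightarrow> int" where
  "subset_path n S i = (if i \<in> {1..<n} then 1 + int (card ({i..<n} - S)) else 0)"

lemma card_Ico_Diff_step:
  assumes "i < n"
  shows "card ({i..<n} - S) = card ({Suc i..<n} - S) + (if i \<in> S then 0 else 1)"
proof -
  have "{i..<n} - S = (if i \<in> S then {Suc i..<n} - S else insert i ({Suc i..<n} - S))"
    using assms by (auto simp: Suc_le_eq order.strict_iff_order)
  then show ?thesis by simp
qed

lemma subset_path_path: "lattice_path n (subset_path n S)"
  by (auto simp: lattice_path_def subset_path_def card_Ico_Diff_step[of _ n S])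

lemma subset_path_bounds:
  assumes "i \<in> {1..<n}"
  shows "1 \<le> subset_path n S i" "subset_path n S i \<le> int n + 1 - int i"
proof -
  have "card ({i..<n} - S) \<le> card {i..<n}" by (intro card_mono) auto
  then show "1 \<le> subset_path n S i" "subset_path n S i \<le> int n + 1 - int i"
    using assms by (auto simp: subset_path_def)
qed

lemma subset_path_all: "subset_path n {1..<n} = const_path n"
proof
  fix i
  have "i \<in> {1..<n} \<Longrightarrow> {i..<n} - {1..<n} = {}" by auto
  then show "subset_path n {1..<n} i = const_path n i"
    by (simp add: subset_path_def const_path_def del: Diff_eq_empty_iff)
qed

lemma subset_path_empty: "subset_path n {} = top_path n"
  by (auto simp: subset_path_def top_path_def)

lemma inj_on_subset_path: "inj_on (subset_path n) (Pow {1..<n})"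
proof (rule inj_onI)
  fix S T assume S: "S \<in> Pow {1..<n}" "T \<in> Pow {1..<n}" and eq: "subset_path n S = subset_path n T"
  have c: "card ({i..<n} - S) = card ({i..<n} - T)" if "1 \<le> i" for i
    using fun_cong[OF eq, of i] that by (cases "i < n") (auto simp: subset_path_def)
  have "i \<in> S \<longleftrightarrow> i \<in> T" if i: "i \<in> {1..<n}" for i
  proof -
    have "1 \<le> i" "1 \<le> Suc i" "i < n" using i by auto
    then have "(if i \<in> S then 0 else 1 :: nat) = (if i \<in> T then 0 else 1)"
      using c[of i] c[of "Suc i"] card_Ico_Diff_step[of i n S] card_Ico_Diff_step[of i n T]
      by linarith
    then show ?thesis by (simp split: if_splits)
  qed
  then show "S = T" using S by blast
qed

lemma ex_subset_path:
  assumes l: "lattice_path n l"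
    and bounds: "\<And>i. i \<in> {1..<n} \<Longrightarrow> 1 \<le> l i \<and> l i \<le> int n + 1 - int i"
  obtains S where "S \<subseteq> {1..<n}" "l = subset_path n S"
proof -
  \<comment> \<open>The virtual entry 1 at position n turns the last position into an ordinary step:
    the bounds leave only 1 and 2 for \<open>l (n - 1)\<close>.\<close>
  define l' where "l' i = (if i = n then 1 else l i)" for i
  define S where "S = {i \<in> {1..<n}. l' i = l' (Suc i)}"
  have step: "l' i = l' (Suc i) \<or> l' i = l' (Suc i) + 1" if i: "i \<in> {1..<n}" for i
  proof (cases "Suc i = n")
    case True
    then show ?thesis using bounds[OF i] by (auto simp: l'_def)
  next
    case False
    then show ?thesis using l i unfolding lattice_path_def l'_def by auto
  qed
  have "l' i = 1 + int (card ({i..<n} - S))" if "1 \<le> i" "i \<le> n" for i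
    using that(2,1)
  proof (induction i rule: inc_induct)
    case base
    then show ?case by (simp add: l'_def)
  next
    case (step i)
    then have i: "i \<in> {1..<n}" by auto
    have "l' i = l' (Suc i) + (if i \<in> S then 0 else 1)"
      using \<open>\<And>i. i \<in> {1..<n} \<Longrightarrow> l' i = l' (Suc i) \<or> l' i = l' (Suc i) + 1\<close>[OF i] i
      by (auto simp: S_def)
    then show ?case using step card_Ico_Diff_step[of i n S] by auto
  qed
  note eq = this
  have "l i = subset_path n S i" for i
  proof (cases "i \<in> {1..<n}")
    case True
    then show ?thesis using eq[of i] by (simp add: subset_path_def l'_def)
  next
    case False
    then show ?thesis using l unfolding subset_path_def lattice_path_def by simp
  qed
  then have "l = subset_path n S" ..
  moreover have "S \<subseteq> {1..<n}" by (auto simp: S_def)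
  ultimately show ?thesis using that by blast
qed

text \<open>Moving the horizontal step from \<open>s\<close> to \<open>s - 1\<close> adds a descent
  at \<open>s\<close>. Entries further left also lose the descent at \<open>s - 1\<close>, so they
  keep their value.\<close>

lemma subset_path_lower_part:
  assumes S: "S \<subseteq> {1..<n}" and s: "s \<in> S" "s - 1 \<notin> S"
  shows "subset_path n (lower_part S s) = (subset_path n S)(s := subset_path n S s + 1)"
proof
  fix j
  have s1: "1 \<le> s" "s < n" using S s by auto
  show "subset_path n (lower_part S s) j = ((subset_path n S)(s := subset_path n S s + 1)) j"
  proof (cases "j \<in> {1..<n}")
    case j: True
    consider "s < j" | "j = s" | "j < s" by linarith
    then have "card ({j..<n} - lower_part S s) = card ({j..<n} - S) + (if j = s then 1 else 0)"
    proof cases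
      case 1
      then have "{j..<n} - lower_part S s = {j..<n} - S" by (auto simp: lower_part_def)
      then show ?thesis using 1 by simp
    next
      case 2
      then have "{j..<n} - lower_part S s = insert s ({j..<n} - S)"
        using s1 by (auto simp: lower_part_def)
      then show ?thesis using 2 s by simp
    next
      case 3
      have e: "{j..<n} - lower_part S s = insert s (({j..<n} - S) - {s - 1})"
        using 3 s1 j by (auto simp: lower_part_def)
      have m: "s - 1 \<in> {j..<n} - S" using 3 s s1 by auto
      have "card ({j..<n} - lower_part S s) = Suc (card (({j..<n} - S) - {s - 1}))"
        unfolding e using s by (intro card_insert_disjoint) auto
      also have "\<dots> = card ({j..<n} - S)"
        using m by (intro card_Suc_Diff1) auto
      finally show ?thesis using 3 by simp
    qed
    then show ?thesis using j by (simp add: subset_path_def)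
  next
    case False
    then show ?thesis using s1 by (auto simp: subset_path_def)
  qed
qed

text \<open>The gap at position \<open>i\<close> is the number of elements of \<open>S\<close> that
  are at least \<open>i\<close>; in exchange, an element \<open>s\<close> is counted by the
  positions 1 to \<open>s\<close>.\<close>

lemma path_dist_subset_path_top:
  assumes S: "S \<subseteq> {1..<n}"
  shows "path_dist n (subset_path n S) (top_path n) = \<Sum>S"
proof -
  have fin: "finite S" using S by (rule finite_subset) simp
  have "nat \<bar>subset_path n S i - top_path n i\<bar> = card ({i..<n} \<inter> S)" if i: "i \<in> {1..<n}" for i
  proof -
    have "card ({i..<n} - S) + card ({i..<n} \<inter> S) = n - i"
      using card_Diff_subset_Int[of "{i..<n}" S] card_mono[of "{i..<n}" "{i..<n} \<inter> S"] by simp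
    then show ?thesis using i by (auto simp: subset_path_def top_path_def)
  qed
  then have "path_dist n (subset_path n S) (top_path n) = (\<Sum>i\<in>{1..<n}. card ({i..<n} \<inter> S))"
    unfolding path_dist_def by (rule sum.cong[OF refl])
  also have "\<dots> = (\<Sum>i\<in>{1..<n}. \<Sum>s\<in>S. if i \<le> s then 1 else 0)"
  proof (rule sum.cong[OF refl])
    fix i assume "i \<in> {1..<n}"
    have "{i..<n} \<inter> S = {s \<in> S. i \<le> s}" using S by auto
    then show "card ({i..<n} \<inter> S) = (\<Sum>s\<in>S. if i \<le> s then 1 else 0)"
      using fin by (simp add: sum.inter_filter[symmetric])
  qed
  also have "\<dots> = (\<Sum>s\<in>S. \<Sum>i\<in>{1..<n}. if i \<le> s then 1 else 0)"
    by (rule sum.swap)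
  also have "\<dots> = \<Sum>S"
  proof (rule sum.cong[OF refl])
    fix s assume "s \<in> S"
    then have "{i \<in> {1..<n}. i \<le> s} = {1..s}" using S by auto
    then show "(\<Sum>i\<in>{1..<n}. if i \<le> s then 1 else 0) = s"
      by (simp add: sum.inter_filter[symmetric])
  qed
  finally show ?thesis .
qed

text \<open>
  On a shortest walk to the top path every step raises one entry, and in terms of step positions this
  replaces some s in S by s - 1.
\<close>

lemma subset_path_walks_rec:
  assumes S: "S \<subseteq> {1..<n}" "S \<noteq> {}"
  shows "path_walks n (subset_path n S) (top_path n) (\<Sum>S) =
    (\<Union>s\<in>{s \<in> S. s - 1 \<notin> S}. (#) (subset_path n S, subset_path n (lower_part S s)) `
       path_walks n (subset_path n (lower_part S s)) (top_path n) (\<Sum>(lower_part S s)))"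
    (is "?L = ?R")
proof -
  have fin: "finite S" and S0: "0 \<notin> S" using S(1) by (auto intro: finite_subset)
  then have pos: "\<Sum>S > 0"
    using S(2) by (metis gr0I sum_eq_0_iff all_not_in_conv)
  have lower: "\<Sum>(lower_part S s) = \<Sum>S - 1" if "s \<in> S" "s - 1 \<notin> S" for s
    using sum_lower_part[OF fin that S0] .
  show ?thesis
  proof (intro equalityI subsetI)
    fix p assume "p \<in> ?L"
    then have p: "path_walk n (subset_path n S) p (top_path n)" "length p = \<Sum>S"
      by (auto simp: path_walks_def)
    then obtain m q where q: "p = (subset_path n S, m) # q" "path_adj n (subset_path n S) m"
      "path_walk n m q (top_path n)" "length q = \<Sum>S - 1"
      using pos by (cases p) auto
    \<comment> \<open>The length of the walk equals the distance to its end, so no step can be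
      wasted.\<close>
    have dm: "path_dist n m (top_path n) < path_dist n (subset_path n S) (top_path n)"
      using path_dist_le_length[OF q(3)] q(4) pos by (simp add: path_dist_subset_path_top[OF S(1)])
    obtain i x where i: "i \<in> {1..<n}" "m = (subset_path n S)(i := x)"
      "x = subset_path n S i + 1 \<or> x = subset_path n S i - 1" and m: "lattice_path n m"
      using q(2) by (auto simp: path_adj_def)
    have "nat \<bar>x - top_path n i\<bar> < nat \<bar>subset_path n S i - top_path n i\<bar>"
      using path_dist_upd[OF i(1), of "subset_path n S" x "top_path n"] dm[unfolded i(2)] by linarith
    then have x: "x = subset_path n S i + 1"
      using i subset_path_bounds(2)[OF i(1), of S] by (auto simp: top_path_def)
    \<comment> \<open>A descent at \<open>i\<close> would become a drop of two. At the last position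
      there is no next entry, but a descent there means that the value is already that of the top
      path.\<close>
    have "i \<in> S"
    proof (rule ccontr)
      assume "i \<notin> S"
      show False
      proof (cases "Suc i = n")
        case True
        then show False
          using \<open>nat \<bar>x - top_path n i\<bar> < _\<close> x i card_Ico_Diff_step[of i n S] \<open>i \<notin> S\<close>
          by (auto simp: subset_path_def top_path_def)
      next
        case False
        then have "m i = m (Suc i) \<or> m i = m (Suc i) + 1"
          using m i(1) unfolding lattice_path_def by auto
        then show False
          using x i False card_Ico_Diff_step[of i n S] \<open>i \<notin> S\<close> by (auto simp: subset_path_def)
      qed
    qed
    moreover have "i - 1 \<notin> S"
    proof
      assume a: "i - 1 \<in> S"
      then have "i - 1 \<noteq> 0" using S0 by metis
      then have j: "1 \<le> i - 1 \<and> Suc (i - 1) < n" "Suc (i - 1) = i" using i(1) by auto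
      then have "m (i - 1) = m i \<or> m (i - 1) = m i + 1"
        using m unfolding lattice_path_def by metis
      then show False
        using x i j card_Ico_Diff_step[of "i - 1" n S] a by (auto simp: subset_path_def)
    qed
    moreover from calculation have "m = subset_path n (lower_part S i)"
      using subset_path_lower_part[OF S(1)] i x by simp
    ultimately show "p \<in> ?R"
      using q lower by (auto simp: path_walks_def)
  next
    fix p assume "p \<in> ?R"
    then obtain s q where s: "s \<in> S" "s - 1 \<notin> S"
      and p: "p = (subset_path n S, subset_path n (lower_part S s)) # q"
      and q: "path_walk n (subset_path n (lower_part S s)) q (top_path n)" "length q = \<Sum>S - 1"
      using lower by (auto simp: path_walks_def)
    have "path_adj n (subset_path n S) (subset_path n (lower_part S s))"
      unfolding path_adj_def using s S subset_path_path subset_path_lower_part[OF S(1) s] by blast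
    then show "p \<in> ?L"
      using p q pos by (auto simp: path_walks_def)
  qed
qed

lemma card_subset_path_walks:
  assumes "S \<subseteq> {1..<n}"
  shows "finite (path_walks n (subset_path n S) (top_path n) (\<Sum>S)) \<and>
    real (card (path_walks n (subset_path n S) (top_path n) (\<Sum>S))) = strict_count S"
  using assms
proof (induction "\<Sum>S" arbitrary: S rule: less_induct)
  case less
  have fin: "finite S" and S0: "0 \<notin> S" using less.prems by (auto intro: finite_subset)
  show ?case
  proof (cases "S = {}")
    case True
    have "path_walks n (subset_path n {}) (top_path n) 0 = {[]}"
      using lattice_path_top by (auto simp: path_walks_def subset_path_empty)
    then show ?thesis
      using True by (simp add: strict_count_def strict_weight_def)
  next
    case False
    then have pos: "\<Sum>S > 0"
      using fin S0 by (metis gr0I sum_eq_0_iff all_not_in_conv)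
    define I where "I = {s \<in> S. s - 1 \<notin> S}"
    define W where "W S = path_walks n (subset_path n S) (top_path n) (\<Sum>S)" for S
    have low: "lower_part S s \<subseteq> {1..<n}" if "s \<in> I" for s
    proof
      fix x assume "x \<in> lower_part S s"
      then have "x \<in> S \<or> (x = s - 1 \<and> x \<noteq> 0)" by (auto simp: lower_part_def)
      moreover have "s < n" using that less.prems by (auto simp: I_def)
      ultimately show "x \<in> {1..<n}" using less.prems by auto
    qed
    have IH: "finite (W (lower_part S s)) \<and> real (card (W (lower_part S s))) = strict_count (lower_part S s)"
      if "s \<in> I" for s
      unfolding W_def
      using that pos sum_lower_part[OF fin _ _ S0, of s] low by (intro less.hyps) (auto simp: I_def)
    have rec: "W S = (\<Union>s\<in>I. (#) (subset_path n S, subset_path n (lower_part S s)) ` W (lower_part S s))"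
      unfolding W_def I_def by (rule subset_path_walks_rec[OF less.prems False])
    \<comment> \<open>The element \<open>s\<close> is lost in the first set and kept in the second.
      Hence walks with different first moves are disjoint families.\<close>
    have "lower_part S s \<noteq> lower_part S t" if "s \<in> I" "t \<in> I" "s \<noteq> t" for s t
    proof
      assume "lower_part S s = lower_part S t"
      moreover have "s \<notin> lower_part S s" "s \<in> lower_part S t"
        using that S0 by (auto simp: lower_part_def I_def)
      ultimately show False by simp
    qed
    then have neq: "subset_path n (lower_part S s) \<noteq> subset_path n (lower_part S t)"
      if "s \<in> I" "t \<in> I" "s \<noteq> t" for s t
      using inj_on_subset_path[THEN inj_onD] low that by (metis PowI)
    have "finite I" using fin by (simp add: I_def)
    moreover have "card (W S) = (\<Sum>s\<in>I. card (W (lower_part S s)))"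
      unfolding rec using \<open>finite I\<close> IH neq
      by (subst card_UN_disjoint) (auto simp: card_image intro!: sum.cong)
    ultimately have "finite (W S)" "real (card (W S)) = (\<Sum>s\<in>I. strict_count (lower_part S s))"
      using IH by (auto simp: rec)
    then show ?thesis
      using strict_count_rec[OF fin S0 False] by (simp add: W_def I_def)
  qed
qed

section \<open>The diameter and the geodesics\<close>

lemma reverse_perm_permutes: "reverse_perm n permutes {1..n}"
proof (rule bij_imp_permutes)
  show "bij_betw (reverse_perm n) {1..n} {1..n}"
    by (rule bij_betw_byWitness[where f' = "reverse_perm n"]) (auto simp: reverse_perm_def)
qed (auto simp: reverse_perm_def)

context arc_cover
begin

abbreviation "bottom_path \<equiv> path_shift n (- 1) (top_path n)"

lemma path_perm_const: "path_perm n (const_path n) = id"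
proof (rule permutes_eq_if_prefix_images_eq[OF path_perm_permutes[OF lattice_path_const] permutes_id])
  fix j assume j: "j \<in> {1..<n}"
  have "cyc n (const_path n j) j = {1..j}"
    using cyc_eq_Icc[of n 1 j] j n by (simp add: const_path_def)
  then show "path_perm n (const_path n) ` {1..j} = id ` {1..j}"
    using path_perm_prefix[OF lattice_path_const j] by simp
qed

lemma path_perm_top: "path_perm n (top_path n) = reverse_perm n"
proof (rule permutes_eq_if_prefix_images_eq[OF path_perm_permutes[OF lattice_path_top] reverse_perm_permutes])
  fix j assume j: "j \<in> {1..<n}"
  have "cyc n (top_path n j) j = {n + 1 - j..n}"
  proof -
    have "1 \<le> n + 1 - j" "n + 1 - j \<le> n" "Suc n - (n + 1 - j) = j" "int (n + 1 - j) = top_path n j"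
      using j by (auto simp: top_path_def)
    then show ?thesis using cyc_eq_Icc[of n "n + 1 - j" n] n by simp
  qed
  moreover have "reverse_perm n ` {1..j} = {n + 1 - j..n}"
  proof -
    have "x \<in> reverse_perm n ` {1..j}" if "x \<in> {n + 1 - j..n}" for x
      using that j by (intro image_eqI[of _ _ "n + 1 - x"]) (auto simp: reverse_perm_def)
    moreover have "reverse_perm n x \<in> {n + 1 - j..n}" if "x \<in> {1..j}" for x
      using that j by (auto simp: reverse_perm_def)
    ultimately show ?thesis by blast
  qed
  ultimately show "path_perm n (top_path n) ` {1..j} = reverse_perm n ` {1..j}"
    using path_perm_prefix[OF lattice_path_top j] by simp
qed

lemma path_dist_const_top: "path_dist n (const_path n) (top_path n) = n choose 2"
  unfolding sum_Ico_reverse_choose_two[symmetric] path_dist_def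
  by (rule sum.cong) (auto simp: const_path_def top_path_def)

lemma path_dist_const_bottom: "path_dist n (const_path n) bottom_path = n choose 2"
  using path_dist_reflect[of n "const_path n" "top_path n"]
  by (simp add: path_reflect_const path_reflect_top path_dist_const_top)

lemma path_dist_const_shift_top:
  assumes "k \<noteq> 0" "k \<noteq> - 1"
  shows "n choose 2 < path_dist n (const_path n) (path_shift n k (top_path n))"
proof -
  \<comment> \<open>The gap at position \<open>i\<close> is |z - i|. The shifts 0 and -1 give
    \<open>z = n\<close> and \<open>z = 0\<close>, the multiples of n enclosing all positions; every
    other multiple is farther away at each position.\<close>
  define z where "z = int n * (k + 1)"
  have term_eq: "\<bar>const_path n i - path_shift n k (top_path n) i\<bar> = \<bar>z - int i\<bar>"
    if "i \<in> {1..<n}" for i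
    using that by (simp add: const_path_def path_shift_def top_path_def z_def algebra_simps)
  have ne: "{1..<n} \<noteq> {}" using n by simp
  consider "k \<ge> 1" | "k \<le> - 2" using assms by linarith
  then show ?thesis
  proof cases
    case 1
    then have "int n * 2 \<le> z" unfolding z_def by (intro mult_left_mono) auto
    then show ?thesis
      unfolding sum_Ico_reverse_choose_two[symmetric] path_dist_def
      using ne by (intro sum_strict_mono) (auto simp: term_eq)
  next
    case 2
    then have "z \<le> int n * (- 1)" unfolding z_def by (intro mult_left_mono) auto
    then show ?thesis
      unfolding sum_Ico_choose_two[symmetric] path_dist_def
      using ne n by (intro sum_strict_mono) (auto simp: term_eq)
  qed
qed

lemma path_dist_const_shift_top_ge:
  "n choose 2 \<le> path_dist n (const_path n) (path_shift n k (top_path n))"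
proof -
  have "path_shift n 0 (top_path n) = top_path n"
    by (rule ext) (simp add: path_shift_def top_path_def)
  then show ?thesis
    using path_dist_const_shift_top[of k] path_dist_const_top path_dist_const_bottom
    by (cases "k = 0"; cases "k = - 1") auto
qed

lemma graph_dist_id_reverse:
  "graph_dist (arc_graph n) id (reverse_perm n) = ereal (real (n choose 2))"
  using graph_dist_path_perm[OF lattice_path_const lattice_path_top] path_dist_const_shift_top_ge
  by (simp add: path_dist_const_top path_perm_const path_perm_top)

lemma id_arc: "id \<in> arc_permutations n"
  using path_perm_arc[OF lattice_path_const] by (simp add: path_perm_const)

lemma reverse_perm_arc: "reverse_perm n \<in> arc_permutations n"
  using path_perm_arc[OF lattice_path_top] by (simp add: path_perm_top)

lemma graph_diameter_arc_graph: "graph_diameter (arc_graph n) = ereal (real (n choose 2))"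
proof (rule antisym)
  have "graph_dist (arc_graph n) u v \<le> ereal (real (n choose 2))"
    if uv: "u \<in> arc_permutations n" "v \<in> arc_permutations n" for u v
  proof -
    obtain l l' where l: "lattice_path n l" "path_perm n l = u" "lattice_path n l'" "path_perm n l' = v"
      using ex_path_perm[OF uv(1)] ex_path_perm[OF uv(2)] by metis
    obtain k where k: "path_dist n l (path_shift n k l') \<le> n choose 2"
      using ex_short_shift[OF l(1,3)] by blast
    have "graph_dist (arc_graph n) u v \<le> ereal (real (path_dist n l (path_shift n k l')))"
      using graph_dist_path_perm_le[OF l(1) lattice_path_shift[OF l(3)]] l
      by (simp add: path_perm_shift)
    also have "\<dots> \<le> ereal (real (n choose 2))" using k by simp
    finally show ?thesis .
  qed
  then show "graph_diameter (arc_graph n) \<le> ereal (real (n choose 2))"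
    unfolding graph_diameter_def by (intro SUP_least) auto
  show "ereal (real (n choose 2)) \<le> graph_diameter (arc_graph n)"
    unfolding graph_diameter_def graph_dist_id_reverse[symmetric]
    using id_arc reverse_perm_arc by (intro SUP_upper2[of "(id, reverse_perm n)"]) auto
qed

section \<open>Geodesics from the identity to the reversal\<close>

lemma shortest_lift:
  assumes "path_walk n (const_path n) p l" "path_perm n l = reverse_perm n" "length p = n choose 2"
  shows "l = top_path n \<or> l = bottom_path"
proof -
  obtain k where k: "l = path_shift n k (top_path n)"
    using path_perm_eq_imp_shift[of l "top_path n"] assms path_walk_ends lattice_path_top path_perm_top
    by metis
  then have "k = 0 \<or> k = - 1"
    using path_dist_const_shift_top[of k] path_dist_le_length[OF assms(1)] assms(3) by fastforce
  moreover have "path_shift n 0 (top_path n) = top_path n"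
    by (rule ext) (simp add: path_shift_def top_path_def)
  ultimately show ?thesis using k by auto
qed

lemma geodesic_id_reverse_iff:
  "geodesic (arc_graph n) id q (reverse_perm n) \<longleftrightarrow>
     awalk id q (reverse_perm n) \<and> length q = n choose 2"
  by (simp add: geodesic_iff_awalk graph_dist_id_reverse)

lemma path_perm_bottom: "path_perm n bottom_path = reverse_perm n"
  by (simp add: path_perm_shift lattice_path_top path_perm_top)

lemma geodesics_eq:
  "{q. geodesic (arc_graph n) id q (reverse_perm n)} = walk_perms n `
     (path_walks n (const_path n) (top_path n) (n choose 2) \<union>
      path_walks n (const_path n) bottom_path (n choose 2))" (is "?L = walk_perms n ` ?R")
proof (intro equalityI subsetI)
  fix q assume "q \<in> ?L"
  then have q: "awalk (path_perm n (const_path n)) q (reverse_perm n)" "length q = n choose 2"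
    by (auto simp: geodesic_id_reverse_iff path_perm_const)
  obtain p l where p: "path_walk n (const_path n) p l" "walk_perms n p = q" "path_perm n l = reverse_perm n"
    using awalk_lift[OF lattice_path_const q(1)] by blast
  then have "l = top_path n \<or> l = bottom_path"
    using shortest_lift q(2) by (metis length_walk_perms)
  then have "p \<in> ?R"
    using p q(2) by (auto simp: path_walks_def)
  then show "q \<in> walk_perms n ` ?R" using p(2) by blast
next
  fix q assume "q \<in> walk_perms n ` ?R"
  then obtain p l where p: "q = walk_perms n p" "length p = n choose 2" "path_walk n (const_path n) p l"
    "path_perm n l = reverse_perm n"
    using path_perm_top path_perm_bottom by (auto simp: path_walks_def)
  then show "q \<in> ?L"
    using awalk_walk_perms[OF p(3)] by (simp add: geodesic_id_reverse_iff path_perm_const)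
qed

lemma top_neq_bottom: "top_path n \<noteq> bottom_path"
proof
  assume "top_path n = bottom_path"
  then have "top_path n 1 = bottom_path 1" by metis
  then show False using n by (simp add: path_shift_def top_path_def)
qed

lemma card_geodesics:
  "real (card {q. geodesic (arc_graph n) id q (reverse_perm n)}) = 2 * strict_count {1..<n}"
proof -
  let ?A = "path_walks n (const_path n) (top_path n) (n choose 2)"
  let ?B = "path_walks n (const_path n) bottom_path (n choose 2)"
  have A: "finite ?A" "real (card ?A) = strict_count {1..<n}"
    using card_subset_path_walks[of "{1..<n}" n] unfolding subset_path_all sum_Ico_choose_two by auto
  have B: "card ?B = card ?A"
    using card_path_walks_reflect[OF lattice_path_const lattice_path_top]
    by (simp add: path_reflect_const path_reflect_top)
  \<comment> \<open>An infinite set would have \<open>card\<close> 0, so a positive count shows that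
    \<open>?B\<close> is finite.\<close>
  have "strict_count {1..<n} > 0"
    unfolding strict_count_def strict_weight_def
    by (intro mult_pos_pos prod_pos ballI divide_pos_pos) auto
  then have "finite ?B" using A(2) B by (intro card_ge_0_finite) auto
  have inj: "inj_on (walk_perms n) (?A \<union> ?B)"
    by (rule inj_onI) (auto simp: path_walks_def intro: walk_perms_inj)
  have "?A \<inter> ?B = {}"
    using path_walk_end_unique top_neq_bottom by (auto simp: path_walks_def)
  then have "card (?A \<union> ?B) = card ?A + card ?B"
    using A(1) \<open>finite ?B\<close> by (intro card_Un_disjoint)
  then show ?thesis
    unfolding geodesics_eq card_image[OF inj] using A B by simp
qed

section \<open>Vertices on geodesics\<close>

lemma geodesic_vertices_eq:
  "{v. \<exists>q. geodesic (arc_graph n) id q (reverse_perm n) \<and> v \<in> set (awalk_verts id q)} =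
     path_perm n ` (path_interval n (const_path n) (top_path n) \<union> path_interval n (const_path n) bottom_path)"
  (is "?L = path_perm n ` ?R")
proof (intro equalityI subsetI)
  fix v assume "v \<in> ?L"
  then obtain q where q: "awalk id q (reverse_perm n)" "length q = n choose 2" "v \<in> set (awalk_verts id q)"
    by (auto simp: geodesic_id_reverse_iff)
  \<comment> \<open>The geodesic is cut at \<open>v\<close> and lifted piece by piece, so that the
    lift \<open>l\<close> of \<open>v\<close> lies on the lifted walk. The end has distance at least
    n choose 2, which forces equality in the triangle inequality.\<close>
  then obtain r s where rs: "q = r @ s" "awalk id r v" "awalk v s (reverse_perm n)"
    using awalk_decomp by blast
  obtain p1 l where p1: "path_walk n (const_path n) p1 l" "walk_perms n p1 = r" "path_perm n l = v"
    using awalk_lift[OF lattice_path_const, of r v] rs(2) path_perm_const by auto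
  have l: "lattice_path n l" using path_walk_ends p1(1) by blast
  obtain p2 l' where p2: "path_walk n l p2 l'" "walk_perms n p2 = s" "path_perm n l' = reverse_perm n"
    using awalk_lift[OF l, of s] rs(3) p1(3) by auto
  obtain k where k: "l' = path_shift n k (top_path n)"
    using path_perm_eq_imp_shift[of l' "top_path n"] p2 path_walk_ends lattice_path_top path_perm_top
    by metis
  have len: "length p1 + length p2 = n choose 2"
    using q(2) rs(1) p1(2) p2(2) by auto
  have le: "path_dist n (const_path n) l' \<le> path_dist n (const_path n) l + path_dist n l l'"
    by (rule path_dist_triangle)
  have bounds: "path_dist n (const_path n) l \<le> length p1" "path_dist n l l' \<le> length p2"
    using path_dist_le_length p1(1) p2(1) by auto
  then have "k = 0 \<or> k = - 1"
    using le len path_dist_const_shift_top[of k] k by fastforce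
  moreover have "path_shift n 0 (top_path n) = top_path n"
    by (rule ext) (simp add: path_shift_def top_path_def)
  ultimately have l': "l' = top_path n \<or> l' = bottom_path" using k by auto
  then have "path_dist n (const_path n) l' = n choose 2"
    using path_dist_const_top path_dist_const_bottom by auto
  then have "l \<in> path_interval n (const_path n) l'"
    using le len bounds l by (simp add: path_interval_def)
  then show "v \<in> path_perm n ` ?R" using l' p1(3) by auto
next
  fix v assume "v \<in> path_perm n ` ?R"
  then obtain l l' where l: "v = path_perm n l" "lattice_path n l"
    and d: "path_dist n (const_path n) l + path_dist n l l' = n choose 2"
    and l': "lattice_path n l'" "path_perm n l' = reverse_perm n"
    using path_dist_const_top path_dist_const_bottom path_perm_top path_perm_bottom
      lattice_path_top lattice_path_shift
    by (auto simp: path_interval_def)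
  obtain p1 where p1: "path_walk n (const_path n) p1 l" "length p1 = path_dist n (const_path n) l"
    using ex_path_walk[OF lattice_path_const l(2)] by blast
  obtain p2 where p2: "path_walk n l p2 l'" "length p2 = path_dist n l l'"
    using ex_path_walk[OF l(2) l'(1)] by blast
  have a: "awalk id (walk_perms n p1) v" "awalk v (walk_perms n p2) (reverse_perm n)"
    using awalk_walk_perms[OF p1(1)] awalk_walk_perms[OF p2(1)] l l' by (simp_all add: path_perm_const)
  let ?q = "walk_perms n p1 @ walk_perms n p2"
  have w: "awalk id ?q (reverse_perm n)" using a by (rule awalk_appendI)
  then have "set (awalk_verts id ?q) = set (awalk_verts id (walk_perms n p1)) \<union> set (awalk_verts v (walk_perms n p2))"
    using a by (simp add: set_awalk_verts_append)
  moreover have "v \<in> set (awalk_verts v (walk_perms n p2))"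
    using a(2) by (cases "walk_perms n p2") auto
  ultimately show "v \<in> ?L"
    using w d p1 p2 by (auto simp: geodesic_id_reverse_iff intro!: exI[of _ ?q])
qed

text \<open>For a sum distance, being between two paths is an entrywise condition, and a single
  entry out of range makes the triangle inequality strict.\<close>

lemma path_interval_const_top:
  "path_interval n (const_path n) (top_path n) = subset_path n ` Pow {1..<n}"
proof (intro equalityI subsetI)
  fix l assume "l \<in> path_interval n (const_path n) (top_path n)"
  then have l: "lattice_path n l"
    and d: "path_dist n (const_path n) l + path_dist n l (top_path n) = path_dist n (const_path n) (top_path n)"
    by (auto simp: path_interval_def)
  have "1 \<le> l i \<and> l i \<le> int n + 1 - int i" if i: "i \<in> {1..<n}" for i
  proof (rule ccontr)
    assume out: "\<not> ?thesis"
    have "path_dist n (const_path n) (top_path n) < path_dist n (const_path n) l + path_dist n l (top_path n)"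
      unfolding path_dist_def sum.distrib[symmetric]
    proof (rule sum_strict_mono_ex1)
      show "\<exists>i\<in>{1..<n}. nat \<bar>const_path n i - top_path n i\<bar>
          < nat \<bar>const_path n i - l i\<bar> + nat \<bar>l i - top_path n i\<bar>"
        using out i by (intro bexI[of _ i]) (auto simp: const_path_def top_path_def)
    qed auto
    then show False using d by simp
  qed
  then show "l \<in> subset_path n ` Pow {1..<n}"
    using ex_subset_path[OF l] by blast
next
  fix l assume "l \<in> subset_path n ` Pow {1..<n}"
  then obtain S where S: "l = subset_path n S" by blast
  have "path_dist n (const_path n) l + path_dist n l (top_path n) = path_dist n (const_path n) (top_path n)"
    unfolding path_dist_def sum.distrib[symmetric]
  proof (rule sum.cong[OF refl])
    fix i assume i: "i \<in> {1..<n}"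
    then show "nat \<bar>const_path n i - l i\<bar> + nat \<bar>l i - top_path n i\<bar> = nat \<bar>const_path n i - top_path n i\<bar>"
      using subset_path_bounds[OF i, of S] S by (auto simp: const_path_def top_path_def)
  qed
  then show "l \<in> path_interval n (const_path n) (top_path n)"
    using S subset_path_path by (simp add: path_interval_def)
qed

lemma card_geodesic_vertices:
  "card {v. \<exists>q. geodesic (arc_graph n) id q (reverse_perm n) \<and> v \<in> set (awalk_verts id q)} = 2 ^ n - 2"
proof -
  define A where "A = path_interval n (const_path n) (top_path n)"
  define B where "B = path_interval n (const_path n) bottom_path"
  have B: "B = path_reflect n ` A"
    using path_interval_reflect[OF lattice_path_const lattice_path_top]
    by (simp add: A_def B_def path_reflect_const path_reflect_top)
  have A_bounds: "1 \<le> l i \<and> l i \<le> int n + 1 - int i" if "l \<in> A" "i \<in> {1..<n}" for l i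
    using that subset_path_bounds[of i n] by (auto simp: A_def path_interval_const_top)
  have B_bounds: "1 - int i \<le> l i \<and> l i \<le> 1" if l: "l \<in> B" and i: "i \<in> {1..<n}" for l i
  proof -
    obtain m where m: "m \<in> A" "l = path_reflect n m" using l B by blast
    have "n - i \<in> {1..<n}" using i by auto
    then show ?thesis
      using A_bounds[OF m(1), of "n - i"] i m(2) by (auto simp: path_reflect_def)
  qed
  have paths: "lattice_path n l" if "l \<in> A \<union> B" for l
    using that by (auto simp: A_def B_def path_interval_def)
  have finA: "finite A" by (simp add: A_def path_interval_const_top)
  have cardA: "card A = 2 ^ (n - 1)"
    unfolding A_def path_interval_const_top card_image[OF inj_on_subset_path]
    by (simp add: card_Pow)
  have "inj_on (path_reflect n) A"
    by (rule inj_on_inverseI[of _ "path_reflect n"]) (simp add: paths path_reflect_reflect)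
  then have cardB: "card B = 2 ^ (n - 1)" using B cardA by (simp add: card_image)
  have one: "1 \<in> {1..<n}" using n by simp
  have shift0: "path_shift n 0 l = l" if "lattice_path n l" for l
    using that by (auto simp: path_shift_def lattice_path_def fun_eq_iff)
  have injA: "inj_on (path_perm n) A"
  proof (rule inj_onI)
    fix l m assume lm: "l \<in> A" "m \<in> A" "path_perm n l = path_perm n m"
    then obtain k where k: "l = path_shift n k m" using path_perm_eq_imp_shift paths by (metis UnI1)
    \<comment> \<open>Position n - 1 is chosen because paths in \<open>A\<close> take only the
      values 1 and 2 there; for \<open>B\<close> position 1 plays this part, with the values 0 and
      1.\<close>
    have i: "n - 1 \<in> {1..<n}" and "int n = int (n - 1) + 1" using n by auto
    moreover have "l (n - 1) = m (n - 1) + int n * k" using i k by (simp only: path_shift_def if_True)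
    ultimately have "- int n < int n * k" "int n * k < int n"
      using A_bounds[OF lm(1) i] A_bounds[OF lm(2) i] n by linarith+
    then have "int n * k = 0" using n by (intro small_multiple[of n]) auto
    then show "l = m" using k shift0 paths lm n by simp
  qed
  have injB: "inj_on (path_perm n) B"
  proof (rule inj_onI)
    fix l m assume lm: "l \<in> B" "m \<in> B" "path_perm n l = path_perm n m"
    then obtain k where k: "l = path_shift n k m" using path_perm_eq_imp_shift paths by (metis UnI2)
    have "l 1 = m 1 + int n * k" using one k by (simp only: path_shift_def if_True)
    then have "- int n < int n * k" "int n * k < int n"
      using B_bounds[OF lm(1) one] B_bounds[OF lm(2) one] n by linarith+
    then have "int n * k = 0" using n by (intro small_multiple[of n]) auto
    then show "l = m" using k shift0 paths lm n by simp
  qed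
  have inter: "path_perm n ` A \<inter> path_perm n ` B = {id, reverse_perm n}"
  proof (intro equalityI subsetI)
    fix v assume "v \<in> path_perm n ` A \<inter> path_perm n ` B"
    then obtain l m where lm: "l \<in> A" "m \<in> B" "v = path_perm n l" "path_perm n m = path_perm n l" by auto
    then obtain k where k: "m = path_shift n k l" using path_perm_eq_imp_shift paths by (metis UnI1 UnI2)
    have mi: "m i = l i + int n * k" if "i \<in> {1..<n}" for i
      using that k by (simp add: path_shift_def)
    \<comment> \<open>At position 1 paths in \<open>A\<close> lie between 1 and n and paths in
      \<open>B\<close> between 0 and 1, so \<open>n * k\<close> lies between -n and 0.\<close>
    have "k > - 2"
    proof (rule ccontr)
      assume "\<not> k > - 2"
      then have "int n * k \<le> int n * (- 2)" by (intro mult_left_mono) auto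
      then show False
        using mi[OF one] A_bounds[OF lm(1) one] B_bounds[OF lm(2) one] n by simp
    qed
    moreover have "k < 1"
    proof (rule ccontr)
      assume "\<not> k < 1"
      then have "int n * 1 \<le> int n * k" by (intro mult_left_mono) auto
      then show False
        using mi[OF one] A_bounds[OF lm(1) one] B_bounds[OF lm(2) one] n by linarith
    qed
    \<comment> \<open>Without a shift the bounds of \<open>A\<close> and \<open>B\<close> meet only
      in the value 1; with shift -1 they force every entry up to the top path.\<close>
    ultimately consider "k = 0" | "k = - 1" by linarith
    then show "v \<in> {id, reverse_perm n}"
    proof cases
      case 1
      have "l i = const_path n i" for i
        using 1 mi[of i] A_bounds[OF lm(1), of i] B_bounds[OF lm(2), of i] paths[of l] lm(1)
        by (cases "i \<in> {1..<n}") (auto simp: const_path_def lattice_path_def)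
      then have "l = const_path n" ..
      then show ?thesis using lm(3) path_perm_const by simp
    next
      case 2
      have "l i = top_path n i" for i
        using 2 mi[of i] A_bounds[OF lm(1), of i] B_bounds[OF lm(2), of i] paths[of l] lm(1)
        by (cases "i \<in> {1..<n}") (auto simp: top_path_def lattice_path_def)
      then have "l = top_path n" ..
      then show ?thesis using lm(3) path_perm_top by simp
    qed
  next
    fix v assume "v \<in> {id, reverse_perm n}"
    moreover have "const_path n \<in> A" "top_path n \<in> A"
      by (auto simp: A_def path_interval_def lattice_path_const lattice_path_top)
    moreover have "const_path n \<in> B" "bottom_path \<in> B"
      by (auto simp: B_def path_interval_def lattice_path_const lattice_path_shift lattice_path_top)
    ultimately show "v \<in> path_perm n ` A \<inter> path_perm n ` B"
      using path_perm_const path_perm_top path_perm_bottom by (metis IntI image_eqI insert_iff empty_iff)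
  qed
  have "id \<noteq> reverse_perm n"
  proof
    assume "id = reverse_perm n"
    then have "id (1::nat) = reverse_perm n 1" by metis
    then show False using n by (simp add: reverse_perm_def)
  qed
  then have "card (path_perm n ` A \<inter> path_perm n ` B) = 2" by (simp add: inter)
  moreover have "card (path_perm n ` A) + card (path_perm n ` B) =
      card (path_perm n ` A \<union> path_perm n ` B) + card (path_perm n ` A \<inter> path_perm n ` B)"
    using finA B by (intro card_Un_Int) auto
  moreover have "2 ^ (n - 1) + 2 ^ (n - 1) = (2::nat) ^ n"
    using n by (cases n) auto
  ultimately have "card (path_perm n ` (A \<union> B)) = 2 ^ n - 2"
    by (simp add: image_Un card_image injA injB cardA cardB)
  then show ?thesis
    unfolding geodesic_vertices_eq A_def B_def .
qed

end

theorem theorem6p1: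
  fixes n :: nat
  assumes "n > 2"
  shows "graph_diameter (arc_graph n) = ereal (real (n choose 2)) \<and>
    antipodes (arc_graph n) id (reverse_perm n) \<and>
    card {v. \<exists>p. geodesic (arc_graph n) id p (reverse_perm n) \<and>
                  v \<in> set (pre_digraph.awalk_verts (arc_graph n) id p)} = 2 ^ n - 2 \<and>
    real (card {p. geodesic (arc_graph n) id p (reverse_perm n)}) =
      2 * fact (n choose 2) * (\<Prod>i = 0..n - 2. fact i / fact (2 * i + 1))"
proof -
  interpret arc_cover n by unfold_locales (rule assms)
  have "strict_count {1..<n} = fact (n choose 2) * (\<Prod>i<n - 1. fact i / fact (2 * i + 1))"
    using strict_weight_staircase[of "n - 1"] assms by (simp add: strict_count_def sum_Ico_choose_two del: One_nat_def)
  also have "{..<n - 1} = {0..n - 2}" using assms by auto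
  finally show ?thesis
    using graph_diameter_arc_graph graph_dist_id_reverse id_arc reverse_perm_arc
      card_geodesic_vertices card_geodesics
    by (simp add: antipodes_def)
qed

end
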